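(* Any finite point set $P$ of $n$ points in the plane can be strongly connected in $O(\log n(\log\log\Delta+\log n))$ slots using the mean power assignment $P_\ell=\ell^{\alpha/2}$, where $\Delta$ is the ratio between the longest and shortest edge lengths in a minimum spanning tree of $P$.
   Context: A link $(s,r)$ is an ordered pair of points with length $d(s,r)$; $d_{xy}=d(s,r')$ for links $x=(s,r)$, $y=(s',r')$. Constants $\alpha>2$, $\beta\ge1$; noise neglected. A set $S$ of links with given powers is feasible (schedulable in one slot) if $\frac{P_\ell/\ell^\alpha}{\sum_{\ell'\in S\setminus\{\ell\}}P_{\ell'}/d_{\ell'\ell}^\alpha}\ge\beta$ for all $\ell\in S$. Strongly connecting $P$ in $k$ slots means choosing a set of links whose directed graph on $P$ is strongly connected and partitioning it into $k$ feasible sets. Constants in $O(\cdot)$ may depend on $\alpha,\beta$. *)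

theory Defs
  imports "HOL-Analysis.Analysis" "HOL-Library.Disjoint_Sets"
begin

type_synonym point = "real ^ 2"

text \<open>A link is a pair (sender, receiver).\<close>

type_synonym link = "point \<times> point"

definition link_length :: "link \<Rightarrow> real" where
  "link_length l = dist (fst l) (snd l)"

text \<open>The distance \<open>d\<^sub>x\<^sub>y\<close> from the sender of \<open>x\<close> to the receiver of \<open>y\<close>.\<close>

definition link_dist :: "link \<Rightarrow> link \<Rightarrow> real" where
  "link_dist x y = dist (fst x) (snd y)"

text \<open>
  Received powers are extended nonnegative reals: in \<^typ>\<open>ennreal\<close> a positive number divided
  by \<open>0\<close> is \<open>\<infinity>\<close>. Hence a sender located at the receiver of \<open>l\<close> causes infinite interference
  (and a signal-to-interference ratio \<open>0\<close>), whereas in the absence of interference the ratio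
  is \<open>\<infinity>\<close>. With division on the reals the interference would wrongly be \<open>0\<close> in the first case.
\<close>

definition sir :: "real \<Rightarrow> (link \<Rightarrow> real) \<Rightarrow> link set \<Rightarrow> link \<Rightarrow> ennreal" where
  "sir \<alpha> pow S l =
     (ennreal (pow l) / ennreal (link_length l powr \<alpha>)) /
     (\<Sum>l'\<in>S - {l}. ennreal (pow l') / ennreal (link_dist l' l powr \<alpha>))"

definition feasible :: "real \<Rightarrow> real \<Rightarrow> (link \<Rightarrow> real) \<Rightarrow> link set \<Rightarrow> bool" where
  "feasible \<alpha> \<beta> pow S \<longleftrightarrow> (\<forall>l\<in>S. sir \<alpha> pow S l \<ge> ennreal \<beta>)"

definition mean_power :: "real \<Rightarrow> link \<Rightarrow> real" where
  "mean_power \<alpha> l = link_length l powr (\<alpha> / 2)"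

definition strongly_connects :: "link set \<Rightarrow> point set \<Rightarrow> bool" where
  "strongly_connects L P \<longleftrightarrow>
     L \<subseteq> P \<times> P \<and> (\<forall>(s, r)\<in>L. s \<noteq> r) \<and> (\<forall>u\<in>P. \<forall>v\<in>P. (u, v) \<in> L\<^sup>*)"

definition strongly_connectable ::
  "real \<Rightarrow> real \<Rightarrow> (link \<Rightarrow> real) \<Rightarrow> point set \<Rightarrow> nat \<Rightarrow> bool" where
  "strongly_connectable \<alpha> \<beta> pow P k \<longleftrightarrow>
     (\<exists>L \<S>. strongly_connects L P \<and> partition_on L \<S> \<and> finite \<S> \<and> card \<S> = k \<and>
        (\<forall>S\<in>\<S>. feasible \<alpha> \<beta> pow S))"

text \<open>
  Undirected edges are two-element sets \<open>{u, v}\<close>; the length of an edge is its diameter,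
  which is \<^term>\<open>dist u v\<close>.
\<close>

definition spanning_tree :: "point set \<Rightarrow> point set set \<Rightarrow> bool" where
  "spanning_tree P T \<longleftrightarrow>
     T \<subseteq> {{u, v} | u v. u \<in> P \<and> v \<in> P \<and> u \<noteq> v} \<and>
     (\<forall>u\<in>P. \<forall>v\<in>P. (u, v) \<in> {(x, y). {x, y} \<in> T}\<^sup>*) \<and>
     \<not> (\<exists>c. length c \<ge> 3 \<and> distinct c \<and>
          (\<forall>i<length c. {c ! i, c ! (Suc i mod length c)} \<in> T))"

definition minimum_spanning_tree :: "point set \<Rightarrow> point set set \<Rightarrow> bool" where
  "minimum_spanning_tree P T \<longleftrightarrow>
     spanning_tree P T \<and>
     (\<forall>T'. spanning_tree P T' \<longrightarrow> (\<Sum>e\<in>T. diameter e) \<le> (\<Sum>e\<in>T'. diameter e))"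

text \<open>Only meaningful for a finite nonempty set of edges.\<close>

definition edge_ratio :: "point set set \<Rightarrow> real" where
  "edge_ratio T = Max (diameter ` T) / Min (diameter ` T)"

text \<open>
  The iterated logarithm, read as \<open>0\<close> for arguments in \<open>[1, 2]\<close>, where \<open>log log x\<close> is
  negative or undefined.
\<close>

definition loglog :: "real \<Rightarrow> real" where
  "loglog x = log 2 (log 2 (max 2 x))"

end

theory Submission
  imports Defs "HOL-Library.Transitive_Closure_Table"
begin

text \<open>
  Proceed in rounds: in the current point set \<open>Q\<close>, link every point to a nearest neighbour in \<open>Q\<close>,
  in both directions, and drop one endpoint of enough of these links, so that \<open>Q\<close> shrinks by a
  constant factor; after \<open>O(log n)\<close> rounds one point remains. It has to be shown that each round
  fits into \<open>O(log n + log log \<Delta>)\<close> slots.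

  Under mean power, the affectance of the link at \<open>x\<close> on the link at \<open>y\<close> is
  \<open>(\<ell>\<^sub>x \<ell>\<^sub>y / d\<^sup>2)\<close> to the power \<open>\<alpha>/2\<close>, with \<open>d\<close> the distance from \<open>x\<close> to the receiver of \<open>y\<close>. Capped at \<open>1\<close>, these
  affectances sum to \<open>O(|Q| (log n + log log \<Delta>))\<close> over all ordered pairs. Balls of radius \<open>\<ell>\<^sub>x/2\<close>
  about the points are disjoint, so if \<open>d\<close> is comparable to the distance of \<open>x\<close> and \<open>y\<close>, an area argument
  bounds the contribution of the longer links to a given link by a constant. Otherwise \<open>y\<close> lies within
  distance \<open>2 \<ell>\<^sub>y\<close> of \<open>x\<close>. For fixed \<open>x\<close> there are boundedly many such \<open>y\<close> per dyadic length class, which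
  handles the \<open>O(log n)\<close> classes with \<open>\<ell>\<^sub>y\<close> at most \<open>32 n\<^sup>2 \<ell>\<^sub>x\<close>. Much longer links either
  contribute at most \<open>1/n\<close> or have their receiver so close to \<open>x\<close> that those whose lengths agree up
  to squaring are seen from \<open>x\<close> in well separated directions: there are boundedly many of them in each of
  \<open>O(log log \<Delta>)\<close> groups.

  A colouring with few colours for which the monochromatic affectances are below average leaves at least
  half of the links feasible in both directions, since reversing all links transposes the affectance matrix.
\<close>

section \<open>Packing and dyadic decompositions\<close>

text \<open>The balls of radius \<open>\<rho> y\<close> about the points \<open>y\<close> are
  disjoint and lie in \<open>ball x R\<close>. Comparing areas, the area of the unit disc
  cancels.\<close>

lemma sum_squares_disjoint_balls:
  fixes A :: "point set" and \<rho> :: "point \<Rightarrow> real"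
  assumes "finite A" and nonneg: "\<And>y. y \<in> A \<Longrightarrow> 0 \<le> \<rho> y" and "0 \<le> R"
    and sep: "\<And>y z. y \<in> A \<Longrightarrow> z \<in> A \<Longrightarrow> y \<noteq> z \<Longrightarrow> \<rho> y + \<rho> z \<le> dist y z"
    and inside: "\<And>y. y \<in> A \<Longrightarrow> dist x y + \<rho> y \<le> R"
  shows "(\<Sum>y\<in>A. (\<rho> y)\<^sup>2) \<le> R\<^sup>2"
proof -
  let ?V = "unit_ball_vol (2::real)"
  have V: "0 < ?V" by simp
  have vol: "measure lebesgue (ball c s) = ?V * s\<^sup>2" if "0 \<le> s" for c :: point and s
    using content_ball[of s c] that by simp
  have fin: "emeasure lborel (ball c s) \<noteq> top" for c :: point and s
    using emeasure_lborel_ball_finite[of c s] by auto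
  have disj: "disjoint_family_on (\<lambda>y. ball y (\<rho> y)) A"
    unfolding disjoint_family_on_def
  proof (intro ballI impI)
    fix y z assume "y \<in> A" "z \<in> A" "y \<noteq> z"
    then have "\<rho> y + \<rho> z \<le> dist y z" by (rule sep)
    then show "ball y (\<rho> y) \<inter> ball z (\<rho> z) = {}"
      by (rule disjoint_ballI)
  qed
  have "?V * (\<Sum>y\<in>A. (\<rho> y)\<^sup>2) = (\<Sum>y\<in>A. measure lebesgue (ball y (\<rho> y)))"
    unfolding sum_distrib_left by (intro sum.cong refl vol[symmetric] nonneg)
  also have "\<dots> = measure lebesgue (\<Union>y\<in>A. ball y (\<rho> y))"
    by (rule measure_finite_Union[symmetric])
      (use assms(1) disj fin in auto)
  also have "\<dots> \<le> measure lebesgue (ball x R)"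
  proof (rule measure_mono_fmeasurable)
    show "(\<Union>y\<in>A. ball y (\<rho> y)) \<subseteq> ball x R"
    proof
      fix w assume "w \<in> (\<Union>y\<in>A. ball y (\<rho> y))"
      then obtain y where y: "y \<in> A" "dist y w < \<rho> y" by auto
      have "dist x w \<le> dist x y + dist y w" by (rule dist_triangle)
      with y inside[of y] show "w \<in> ball x R" by auto
    qed
  qed (use assms(1) in \<open>auto intro!: sets.finite_UN\<close>)
  also have "\<dots> = ?V * R\<^sup>2" using \<open>0 \<le> R\<close> by (rule vol)
  finally show ?thesis using V by simp
qed

text \<open>Packing: disjoint discs of radius \<open>D / 2\<close> about the points fit into a disc
  of radius \<open>R + D / 2\<close>.\<close>

lemma card_separated:
  fixes A :: "point set"
  assumes "finite A" "0 \<le> R" "0 < D"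
    and sep: "\<And>y z. y \<in> A \<Longrightarrow> z \<in> A \<Longrightarrow> y \<noteq> z \<Longrightarrow> D \<le> dist y z"
    and inside: "\<And>y. y \<in> A \<Longrightarrow> dist x y \<le> R"
  shows "real (card A) \<le> (2 * R / D + 1)\<^sup>2"
proof -
  have "(\<Sum>y\<in>A. (D/2)\<^sup>2) \<le> (R + D/2)\<^sup>2"
    by (rule sum_squares_disjoint_balls[of _ _ _ x]) (use assms in auto)
  then have "real (card A) * (D/2)\<^sup>2 \<le> (R + D/2)\<^sup>2" by simp
  then have "real (card A) \<le> (R + D/2)\<^sup>2 / (D/2)\<^sup>2"
    using \<open>0 < D\<close> by (simp add: pos_le_divide_eq)
  also have "\<dots> = ((R + D/2) / (D/2))\<^sup>2" by (simp only: power_divide)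
  also have "(R + D/2) / (D/2) = 2 * R / D + 1" using \<open>0 < D\<close> by (simp add: field_simps)
  finally show ?thesis .
qed

lemma nat_floor_log_eq_iff:
  fixes t :: real
  assumes "1 \<le> t"
  shows "nat \<lfloor>log 2 t\<rfloor> = k \<longleftrightarrow> 2 ^ k \<le> t \<and> t < 2 ^ Suc k"
proof -
  have "nat \<lfloor>log 2 t\<rfloor> = k \<longleftrightarrow> \<lfloor>log 2 t\<rfloor> = int k" using assms by auto
  also have "\<dots> \<longleftrightarrow> real k \<le> log 2 t \<and> log 2 t < real (Suc k)"
    by (simp add: floor_eq_iff add.commute)
  also have "\<dots> \<longleftrightarrow> 2 powr real k \<le> t \<and> t < 2 powr real (Suc k)"
    using assms by (subst le_log_iff, simp, simp, subst log_less_iff) auto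
  also have "\<dots> \<longleftrightarrow> 2 ^ k \<le> t \<and> t < 2 ^ Suc k"
    by (simp only: powr_realpow zero_less_numeral)
  finally show ?thesis .
qed

lemma card_dyadic:
  fixes f :: "'a \<Rightarrow> real"
  assumes fin: "finite A" and ge: "\<And>y. y \<in> A \<Longrightarrow> 1 \<le> f y" and lt: "\<And>y. y \<in> A \<Longrightarrow> f y < 2 ^ m"
    and fib: "\<And>k. real (card {y \<in> A. 2 ^ k \<le> f y \<and> f y < 2 ^ Suc k}) \<le> c"
  shows "real (card A) \<le> c * real m"
proof -
  let ?B = "\<lambda>k::nat. {y \<in> A. 2 ^ k \<le> f y \<and> f y < 2 ^ Suc k}"
  have "A \<subseteq> (\<Union>k<m. ?B k)"
  proof
    fix y assume y: "y \<in> A"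
    obtain k :: nat where k: "2 ^ k \<le> f y" "f y < 2 ^ Suc k"
      using nat_floor_log_eq_iff[OF ge[OF y]] by blast
    have "(2::real) ^ k < 2 ^ m" using k(1) lt[OF y] by linarith
    then have "k < m" by (rule power_less_imp_less_exp[rotated]) simp
    then show "y \<in> (\<Union>k<m. ?B k)" using y k by blast
  qed
  then have "card A \<le> card (\<Union>k<m. ?B k)" using fin by (intro card_mono) auto
  also have "\<dots> \<le> (\<Sum>k<m. card (?B k))" by (rule card_UN_le) simp
  finally have "real (card A) \<le> real (\<Sum>k<m. card (?B k))" by (rule of_nat_mono)
  also have "\<dots> = (\<Sum>k<m. real (card (?B k)))" by (rule of_nat_sum)
  also have "\<dots> \<le> (\<Sum>k<m. c)" by (intro sum_mono fib)
  finally show ?thesis by (simp add: mult.commute)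
qed

text \<open>Each dyadic class of \<open>f\<close> is bounded by one term of a geometric series, and
  the series over the classes that occur is at most the full one.\<close>

lemma sum_dyadic:
  fixes f g :: "'a \<Rightarrow> real"
  assumes fin: "finite A" and ge: "\<And>y. y \<in> A \<Longrightarrow> 1 \<le> f y" and "0 < q" "q < 1" "0 \<le> c"
    and fib: "\<And>k. (\<Sum>y | y \<in> A \<and> 2 ^ k \<le> f y \<and> f y < 2 ^ Suc k. g y) \<le> c * q ^ k"
  shows "(\<Sum>y\<in>A. g y) \<le> c / (1 - q)"
proof -
  define h where "h y = nat \<lfloor>log 2 (f y)\<rfloor>" for y
  have h: "2 ^ k \<le> f y \<and> f y < 2 ^ Suc k \<longleftrightarrow> h y = k" if "y \<in> A" for y k
    unfolding h_def using nat_floor_log_eq_iff[OF ge[OF that]] by simp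
  have "(\<Sum>y\<in>A. g y) = (\<Sum>k\<in>h ` A. \<Sum>y | y \<in> A \<and> h y = k. g y)"
    using fin by (rule sum.image_gen)
  also have "\<dots> = (\<Sum>k\<in>h ` A. \<Sum>y | y \<in> A \<and> 2 ^ k \<le> f y \<and> f y < 2 ^ Suc k. g y)"
    by (intro sum.cong refl) (use h in auto)
  also have "\<dots> \<le> (\<Sum>k\<in>h ` A. c * q ^ k)" by (intro sum_mono fib)
  also have "\<dots> = c * (\<Sum>k\<in>h ` A. q ^ k)" by (simp add: sum_distrib_left)
  also have "(\<Sum>k\<in>h ` A. q ^ k) \<le> (\<Sum>k. q ^ k)"
    using assms by (intro sum_le_suminf summable_geometric) auto
  also have "(\<Sum>k. q ^ k) = 1 / (1 - q)" using assms by (intro suminf_geometric) auto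
  finally show ?thesis using \<open>0 \<le> c\<close> by (simp add: mult_left_mono)
qed

text \<open>Radial projection from \<open>x\<close> onto the unit circle leaves the points
  \<open>1/2\<close> apart, so packing with \<open>R = 1\<close> and \<open>D = 1/2\<close> gives
  \<open>(4 + 1)^2 = 25\<close>. For \<open>y\<close> the farther point, the hypothesis puts
  \<open>dist y z\<close> above the difference of the radii by at least half of
  \<open>dist x z\<close>.\<close>

lemma card_angularly_separated:
  fixes A :: "point set"
  assumes fin: "finite A" and "x \<notin> A"
    and sep: "\<And>y z. y \<in> A \<Longrightarrow> z \<in> A \<Longrightarrow> y \<noteq> z \<Longrightarrow> dist x y - dist x z / 2 \<le> dist y z"
  shows "real (card A) \<le> 25"
proof -
  define u where "u y = (y - x) /\<^sub>R norm (y - x)" for y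
  have main: "1/2 \<le> dist (u y) (u z)" if "y \<in> A" "z \<in> A" "y \<noteq> z" and le: "dist x z \<le> dist x y" for y z
  proof -
    let ?a = "norm (y - x)" and ?b = "norm (z - x)"
    have b: "0 < ?b" and a: "0 < ?a" using that assms(2) by auto
    \<comment> \<open>A radial move between the two distances, and a move along the chord between
      the two directions.\<close>
    have "y - z = (?a - ?b) *\<^sub>R u y + ?b *\<^sub>R (u y - u z)"
      using a b by (simp add: u_def algebra_simps)
    then have "dist y z \<le> norm ((?a - ?b) *\<^sub>R u y) + norm (?b *\<^sub>R (u y - u z))"
      unfolding dist_norm by (metis norm_triangle_ineq)
    also have "\<dots> = (?a - ?b) + ?b * dist (u y) (u z)"
      using a le by (simp add: u_def dist_norm norm_minus_commute)
    finally have "?a - ?b / 2 \<le> (?a - ?b) + ?b * dist (u y) (u z)"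
      using sep[OF that(1-3)] by (simp add: dist_norm norm_minus_commute)
    then have "?b * (1/2) \<le> ?b * dist (u y) (u z)" by simp
    then show ?thesis using b by (simp only: mult_le_cancel_left_pos)
  qed
  have u_sep: "1/2 \<le> dist (u y) (u z)" if "y \<in> A" "z \<in> A" "y \<noteq> z" for y z
    using main[of y z] main[of z y] that by (metis dist_commute linear)
  have "inj_on u A"
  proof (rule inj_onI)
    fix y z assume yz: "y \<in> A" "z \<in> A" and eq: "u y = u z"
    show "y = z" using u_sep[OF yz] eq by (cases "y = z") auto
  qed
  then have "real (card A) = real (card (u ` A))" by (simp add: card_image)
  also have "\<dots> \<le> (2 * 1 / (1/2) + 1)\<^sup>2"
  proof (rule card_separated[of _ _ _ 0])
    show "1/2 \<le> dist v w" if "v \<in> u ` A" "w \<in> u ` A" "v \<noteq> w" for v w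
      using that u_sep by (metis imageE)
    show "dist 0 v \<le> 1" if "v \<in> u ` A" for v
      using that by (cases "v = 0") (auto simp: u_def)
  qed (use fin in auto)
  finally show ?thesis by simp
qed

section \<open>Affectances of nearest-neighbour links\<close>

locale nearest_neighbours =
  fixes Q :: "point set" and r :: "point \<Rightarrow> point"
  assumes finite_Q: "finite Q"
    and r_in: "x \<in> Q \<Longrightarrow> r x \<in> Q"
    and r_neq: "x \<in> Q \<Longrightarrow> r x \<noteq> x"
    and r_nearest: "x \<in> Q \<Longrightarrow> y \<in> Q \<Longrightarrow> y \<noteq> x \<Longrightarrow> dist x (r x) \<le> dist x y"
begin

definition len :: "point \<Rightarrow> real" where
  "len x = dist x (r x)"

text \<open>
  For \<open>x = r y\<close> the sender of one link is the receiver of the other, and division would wrongly give \<open>0\<close>.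
  The value is the affectance of \<open>(x, r x)\<close> on \<open>(y, r y)\<close> as well as that of \<open>(r y, y)\<close> on \<open>(r x, x)\<close>.
\<close>

definition capped_affectance :: "real \<Rightarrow> point \<Rightarrow> point \<Rightarrow> real" where
  "capped_affectance \<alpha> x y =
     (if x = r y then 1 else min 1 ((len x * len y / (dist x (r y))\<^sup>2) powr (\<alpha> / 2)))"

lemma len_pos: "x \<in> Q \<Longrightarrow> 0 < len x"
  using r_neq[of x] by (auto simp: len_def)

lemma len_le_dist: "x \<in> Q \<Longrightarrow> y \<in> Q \<Longrightarrow> x \<noteq> y \<Longrightarrow> len x \<le> dist x y"
  using r_nearest[of x y] by (auto simp: len_def)

lemma len_le_dist': "x \<in> Q \<Longrightarrow> y \<in> Q \<Longrightarrow> x \<noteq> y \<Longrightarrow> len y \<le> dist x y"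
  using r_nearest[of y x] by (auto simp: len_def dist_commute)

lemma capped_affectance_nonneg: "0 \<le> capped_affectance \<alpha> x y"
  by (simp add: capped_affectance_def)

lemma capped_affectance_le_1: "capped_affectance \<alpha> x y \<le> 1"
  by (simp add: capped_affectance_def)

text \<open>In each dyadic class of \<open>dist x y / len x\<close> an area bound controls the sum
  of \<open>(len y)^2\<close>, while a leftover power of \<open>len x / dist x y\<close> decays
  geometrically because \<open>\<alpha>\<close> exceeds 2. The factor 4 pays for receivers at
  distance only \<open>dist x y / 2\<close> from \<open>x\<close>.\<close>

lemma sum_affectance_longer:
  fixes \<alpha> :: real
  assumes "2 < \<alpha>" and x: "x \<in> Q"
  shows "(\<Sum>y | y \<in> Q - {x} \<and> len x \<le> len y. (4 * (len x * len y / (dist x y)\<^sup>2)) powr (\<alpha> / 2))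
    \<le> 36 * 2 powr \<alpha> / (1 - 2 powr - (min \<alpha> 4 - 2))"
proof -
  \<comment> \<open>The cap at 4 keeps \<open>1 - \<eta> / 2\<close> nonnegative, as the exchange of
    \<open>?u\<close> for \<open>?v\<close> below requires.\<close>
  define \<eta> where "\<eta> = min \<alpha> 4 - 2"
  have \<eta>: "0 < \<eta>" "\<eta> \<le> 2" "\<eta> \<le> \<alpha> - 2" using assms(1) by (auto simp: \<eta>_def)
  let ?A = "{y. y \<in> Q - {x} \<and> len x \<le> len y}"
  let ?f = "\<lambda>y. dist x y / len x"
  let ?g = "\<lambda>y. (4 * (len x * len y / (dist x y)\<^sup>2)) powr (\<alpha> / 2)"
  have lx: "0 < len x" using x by (rule len_pos)
  txt \<open>
    Lowering the exponent \<open>\<alpha>/2\<close> to at most \<open>2\<close> leaves a factor \<open>len y ^ 2\<close>, whose sum is bounded by an area.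
  \<close>
  have pointwise: "?g y \<le> 2 powr \<alpha> * ((len y / dist x y)\<^sup>2 * (len x / dist x y) powr \<eta>)" if "y \<in> ?A" for y
  proof -
    let ?u = "len x / dist x y" and ?v = "len y / dist x y"
    have d: "0 < dist x y" "len y \<le> dist x y" "len x \<le> len y"
      using that x len_le_dist'[of x y] by auto
    have uv: "0 < ?u" "?u \<le> ?v" "?v \<le> 1" using d lx by (auto simp: divide_right_mono)
    have uv1: "0 \<le> ?u * ?v" "?u * ?v \<le> 1"
      using uv by (intro mult_nonneg_nonneg; linarith) (intro mult_le_one; use uv in linarith)
    have "len x * len y / (dist x y)\<^sup>2 = ?u * ?v" by (simp add: power2_eq_square)
    then have "?g y = 4 powr (\<alpha> / 2) * (?u * ?v) powr (\<alpha> / 2)"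
      using uv by (simp only: powr_mult)
    also have "4 powr (\<alpha> / 2) = (2 powr \<alpha> :: real)"
    proof -
      have "4 powr (\<alpha> / 2) = ((2::real) powr 2) powr (\<alpha> / 2)" by simp
      also have "\<dots> = 2 powr \<alpha>" by (subst powr_powr) simp
      finally show ?thesis .
    qed
    also have "(?u * ?v) powr (\<alpha> / 2) \<le> (?u * ?v) powr (\<eta> / 2 + 1)"
      using uv1 \<eta> by (intro powr_mono') linarith+
    also have "\<dots> = ?v powr (\<eta> / 2 + 1) * ?u powr (\<eta> / 2 + 1)"
      by (subst powr_mult) (rule mult.commute)
    also have "?u powr (\<eta> / 2 + 1) = ?u powr \<eta> * ?u powr (1 - \<eta> / 2)"
      by (simp flip: powr_add)
    \<comment> \<open>As \<open>len x \<le> len y\<close>, part of the power of \<open>?u\<close>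
      may be replaced by a power of \<open>?v\<close>, chosen to make the exponent of
      \<open>?v\<close> equal to 2.\<close>
    also have "?v powr (\<eta> / 2 + 1) * (?u powr \<eta> * ?u powr (1 - \<eta> / 2))
        \<le> ?v powr (\<eta> / 2 + 1) * (?u powr \<eta> * ?v powr (1 - \<eta> / 2))"
      using uv \<eta> by (intro mult_left_mono powr_mono2) auto
    also have "\<dots> = (?v powr (\<eta> / 2 + 1) * ?v powr (1 - \<eta> / 2)) * ?u powr \<eta>"
      by (simp add: ac_simps)
    also have "?v powr (\<eta> / 2 + 1) * ?v powr (1 - \<eta> / 2) = ?v powr 2"
      by (simp flip: powr_add)
    also have "\<dots> = ?v\<^sup>2" using uv by (subst powr_numeral) auto
    finally show ?thesis by (simp add: mult_left_mono)
  qed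
  have "(\<Sum>y\<in>?A. ?g y) \<le> 36 * 2 powr \<alpha> / (1 - 2 powr - \<eta>)"
  proof (rule sum_dyadic[where f = ?f])
    show "finite ?A" using finite_Q by auto
    show "1 \<le> ?f y" if "y \<in> ?A" for y using that x lx len_le_dist[of x y] by auto
    show "0 < 2 powr - \<eta>" "2 powr - \<eta> < 1" using \<eta> by (auto simp: powr_less_one)
    show "0 \<le> 36 * 2 powr \<alpha>" by simp
    fix k :: nat
    let ?S = "{y. y \<in> ?A \<and> 2 ^ k \<le> ?f y \<and> ?f y < 2 ^ Suc k}"
    let ?q = "2 powr - \<eta>"
    \<comment> \<open>Here \<open>dist x y\<close> is below \<open>2 * 2 ^ k * len x\<close> and
      \<open>len y / 2\<close> is at most half of \<open>dist x y\<close>, so 3 suffices. Undoing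
      the halved radii gives \<open>36 = 4 * 3^2\<close>.\<close>
    have "(\<Sum>y\<in>?S. (len y / 2)\<^sup>2) \<le> (3 * 2 ^ k * len x)\<^sup>2"
    proof (rule sum_squares_disjoint_balls[where x = x])
      show "finite ?S" using finite_Q by auto
      show "0 \<le> len y / 2" for y by (simp add: len_def)
      show "0 \<le> 3 * 2 ^ k * len x" using lx by simp
      show "len y / 2 + len z / 2 \<le> dist y z" if "y \<in> ?S" "z \<in> ?S" "y \<noteq> z" for y z
        using that len_le_dist[of y z] len_le_dist'[of y z] by auto
      show "dist x y + len y / 2 \<le> 3 * 2 ^ k * len x" if "y \<in> ?S" for y
      proof -
        have "dist x y < 2 * 2 ^ k * len x" using that lx by (auto simp: pos_divide_less_eq)
        moreover have "len y \<le> dist x y" using that x len_le_dist'[of x y] by auto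
        ultimately show ?thesis by simp
      qed
    qed
    then have area: "(\<Sum>y\<in>?S. (len y)\<^sup>2) \<le> 36 * (2 ^ k * len x)\<^sup>2"
      by (simp add: power_divide power_mult_distrib flip: sum_divide_distrib)
    have "(\<Sum>y\<in>?S. ?g y) \<le> (\<Sum>y\<in>?S. 2 powr \<alpha> * ((len y)\<^sup>2 / (2 ^ k * len x)\<^sup>2 * ?q ^ k))"
    proof (rule sum_mono)
      fix y assume y: "y \<in> ?S"
      then have d: "2 ^ k * len x \<le> dist x y" using lx by (auto simp: pos_le_divide_eq)
      have p: "0 < 2 ^ k * len x" using lx by simp
      have "(len y / dist x y)\<^sup>2 \<le> (len y)\<^sup>2 / (2 ^ k * len x)\<^sup>2"
        unfolding power_divide using d p
        by (intro divide_left_mono power_mono mult_pos_pos) (auto intro: less_le_trans)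
      moreover have "(len x / dist x y) powr \<eta> \<le> (1 / 2 ^ k) powr \<eta>"
      proof (rule powr_mono2)
        show "len x / dist x y \<le> 1 / 2 ^ k"
          using d p by (simp add: divide_simps ac_simps)
      qed (use lx \<eta> in auto)
      moreover have "(1 / 2 ^ k) powr \<eta> = ?q ^ k"
        by (simp add: powr_minus powr_divide power_divide inverse_eq_divide powr_power powr_powr
            flip: powr_realpow) (simp add: mult.commute)
      ultimately have "(len y / dist x y)\<^sup>2 * (len x / dist x y) powr \<eta> \<le> (len y)\<^sup>2 / (2 ^ k * len x)\<^sup>2 * ?q ^ k"
        by (intro mult_mono) auto
      then have "2 powr \<alpha> * ((len y / dist x y)\<^sup>2 * (len x / dist x y) powr \<eta>)
          \<le> 2 powr \<alpha> * ((len y)\<^sup>2 / (2 ^ k * len x)\<^sup>2 * ?q ^ k)" by (intro mult_left_mono) auto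
      with pointwise[of y] y show "?g y \<le> 2 powr \<alpha> * ((len y)\<^sup>2 / (2 ^ k * len x)\<^sup>2 * ?q ^ k)"
        by auto
    qed
    also have "\<dots> = 2 powr \<alpha> * ?q ^ k * ((\<Sum>y\<in>?S. (len y)\<^sup>2) / (2 ^ k * len x)\<^sup>2)"
      by (simp add: sum_distrib_left sum_divide_distrib ac_simps)
    also have "\<dots> \<le> 2 powr \<alpha> * ?q ^ k * 36"
      using area lx by (intro mult_left_mono) (auto simp: pos_divide_le_eq)
    finally show "(\<Sum>y\<in>?S. ?g y) \<le> 36 * 2 powr \<alpha> * ?q ^ k" by simp
  qed
  then show ?thesis by (simp add: \<eta>_def)
qed

text \<open>By the triangle inequality the link of \<open>y\<close> covers more than half of the
  distance from \<open>y\<close> to \<open>x\<close>, which in turn is at least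
  \<open>len x\<close>.\<close>

lemma near_receiver:
  assumes "x \<in> Q" "y \<in> Q" "x \<noteq> y" "dist x (r y) < dist x y / 2"
  shows "dist x y < 2 * len y" "len x < 2 * len y"
proof -
  have "dist x y \<le> dist x (r y) + len y"
    using dist_triangle2[of x y "r y"] by (simp add: len_def)
  then show "dist x y < 2 * len y" using assms(4) by linarith
  then show "len x < 2 * len y" using len_le_dist[OF assms(1-3)] by linarith
qed

text \<open>By \<open>near_receiver\<close> the ratio \<open>2 * len y / len x\<close> is at least
  1, and it stays below \<open>2 * M\<close>. Senders of one dyadic class have lengths from
  \<open>D\<close> up to \<open>2 * D\<close>: they are \<open>D\<close> apart and within
  \<open>4 * D\<close> of \<open>x\<close>, so there are at most
  \<open>(8 + 1)^2 = 81\<close>.\<close>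

lemma card_near_receiver_moderate:
  assumes x: "x \<in> Q" and "1 \<le> M"
  shows "real (card {y \<in> Q - {x}. dist x (r y) < dist x y / 2 \<and> len y < M * len x}) \<le> 81 * (log 2 M + 2)"
proof -
  let ?A = "{y \<in> Q - {x}. dist x (r y) < dist x y / 2 \<and> len y < M * len x}"
  let ?f = "\<lambda>y. 2 * len y / len x"
  define m where "m = nat \<lceil>log 2 (2 * M)\<rceil>"
  have lx: "0 < len x" using x by (rule len_pos)
  have logM: "log 2 (2 * M) = 1 + log 2 M" using assms(2) by (simp add: log_mult)
  have m: "real m \<le> log 2 M + 2" "log 2 (2 * M) \<le> real m"
    using assms(2) unfolding m_def logM by (auto intro: order_trans[OF of_int_ceiling_le_add_one]) 
  have "2 * M = 2 powr log 2 (2 * M)" using assms(2) by simp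
  also have "\<dots> \<le> 2 powr real m" using m by (intro powr_mono) auto
  finally have M: "2 * M \<le> 2 ^ m" by (simp add: powr_realpow)
  have "real (card ?A) \<le> 81 * real m"
  proof (rule card_dyadic[where f = ?f])
    show "finite ?A" using finite_Q by auto
    show "1 \<le> ?f y" if "y \<in> ?A" for y
      using that x lx near_receiver[of x y] by auto
    show "?f y < 2 ^ m" if "y \<in> ?A" for y
    proof -
      have "?f y < 2 * M" using that lx by (auto simp: pos_divide_less_eq)
      with M show ?thesis by linarith
    qed
    fix k :: nat
    let ?S = "{y \<in> ?A. 2 ^ k \<le> ?f y \<and> ?f y < 2 ^ Suc k}"
    define D where "D = 2 ^ k * len x / 2"
    have D: "0 < D" using lx by (simp add: D_def)
    have S: "D \<le> len y" "len y < 2 * D" if "y \<in> ?S" for y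
      using that lx by (auto simp: D_def pos_le_divide_eq pos_divide_less_eq)
    have "real (card ?S) \<le> (2 * (4 * D) / D + 1)\<^sup>2"
    proof (rule card_separated[where x = x])
      show "finite ?S" using finite_Q by auto
      show "D \<le> dist y z" if "y \<in> ?S" "z \<in> ?S" "y \<noteq> z" for y z
        using S(1)[OF that(1)] that len_le_dist[of y z] by auto
      show "dist x y \<le> 4 * D" if "y \<in> ?S" for y
        using S(2)[OF that(1)] that x near_receiver[of x y] by auto
    qed (use D in auto)
    then show "real (card ?S) \<le> 81" using D by simp
  qed
  with m show ?thesis by simp
qed

text \<open>Dyadic classes are taken of \<open>log 2 (v y)\<close> instead of the length, so only
  about \<open>loglog R\<close> of them occur. Within a class, \<open>r y\<close> is close to
  \<open>x\<close> on the scale of the other lengths; thus \<open>dist x y\<close> barely exceeds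
  \<open>len y\<close>, while no other sender is closer to \<open>y\<close> than
  \<open>len y\<close>. This is angular separation as seen from \<open>x\<close>.\<close>

lemma card_near_receiver_conflicting:
  assumes x: "x \<in> Q" and "1 \<le> N" and R: "\<And>y. y \<in> Q \<Longrightarrow> len y \<le> R * len x"
  shows "real (card {y \<in> Q - {x}. (dist x (r y))\<^sup>2 < N\<^sup>2 * len x * len y \<and> 32 * N\<^sup>2 * len x \<le> len y})
    \<le> 25 * (loglog R + 1)"
proof -
  let ?A = "{y \<in> Q - {x}. (dist x (r y))\<^sup>2 < N\<^sup>2 * len x * len y \<and> 32 * N\<^sup>2 * len x \<le> len y}"
  \<comment> \<open>With 16, \<open>v y\<close> is at least 2 and its logarithm at least 1. Moreover
    \<open>N\<^sup>2 * len x * len y = len y * c / 16\<close>, the source of the radius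
    \<open>len z / 4\<close>.\<close>
  define c where "c = 16 * N\<^sup>2 * len x"
  define v where "v y = len y / c" for y
  define L where "L = log 2 (max 2 R)"
  define k where "k = nat \<lfloor>log 2 L\<rfloor>"
  have lx: "0 < len x" using x by (rule len_pos)
  have N: "1 \<le> N\<^sup>2" using assms(2) by simp
  have c: "0 < c" unfolding c_def using N lx by (intro mult_pos_pos) linarith+
  have "log 2 2 \<le> L" unfolding L_def by (subst log_le_cancel_iff) auto
  then have L: "1 \<le> L" by simp
  have Lk: "L < 2 ^ Suc k" using nat_floor_log_eq_iff[OF L, of k] by (simp add: k_def)
  have "real k \<le> loglog R" using L by (simp add: k_def loglog_def flip: L_def)
  have v2: "2 \<le> v y" if "y \<in> ?A" for y using that c by (auto simp: v_def c_def pos_le_divide_eq)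
  have "real (card ?A) \<le> 25 * real (Suc k)"
  proof (rule card_dyadic[where f = "\<lambda>y. log 2 (v y)"])
    show "finite ?A" using finite_Q by auto
    show "1 \<le> log 2 (v y)" if "y \<in> ?A" for y
      using v2[OF that] by (subst le_log_iff) auto
    show "log 2 (v y) < 2 ^ Suc k" if "y \<in> ?A" for y
    proof -
      have "v y \<le> len y / len x" unfolding v_def c_def using lx N len_pos[of y] that
        by (intro divide_left_mono mult_pos_pos) (auto simp: mult_le_cancel_right1)
      also have "\<dots> \<le> R" using R[of y] that lx by (auto simp: pos_divide_le_eq)
      finally have "log 2 (v y) \<le> L" unfolding L_def
        using v2[OF that] by (subst log_le_cancel_iff) auto
      with Lk show ?thesis by linarith
    qed
    fix j :: nat
    let ?S = "{y \<in> ?A. 2 ^ j \<le> log 2 (v y) \<and> log 2 (v y) < 2 ^ Suc j}"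
    txt \<open>Within a group \<open>v y \<le> (v z)\<^sup>2\<close>, which puts the receiver of \<open>y\<close> within \<open>len z / 4\<close> of \<open>x\<close>.\<close>
    show "real (card ?S) \<le> 25"
    proof (rule card_angularly_separated[where x = x])
      show "finite ?S" using finite_Q by auto
      show "x \<notin> ?S" by simp
      fix y z assume y: "y \<in> ?S" and z: "z \<in> ?S" and neq: "y \<noteq> z"
      have yQ: "y \<in> Q" "y \<noteq> x" and zQ: "z \<in> Q" "z \<noteq> x" using y z by auto
      have lz: "0 < len z" using zQ len_pos by simp
      have "log 2 (v y) \<le> 2 * log 2 (v z)" using y z by auto
      also have "\<dots> = log 2 ((v z)\<^sup>2)" using v2[of z] z by (simp add: log_nat_power)
      finally have "v y \<le> (v z)\<^sup>2" using v2[of y] v2[of z] y z by (subst (asm) log_le_cancel_iff) auto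
      then have "len y * c \<le> (len z)\<^sup>2"
        using mult_right_mono[of "v y" "(v z)\<^sup>2" "c\<^sup>2"] c
        by (simp add: v_def power_divide power2_eq_square)
      moreover have "(dist x (r y))\<^sup>2 < N\<^sup>2 * len x * len y" using y by auto
      ultimately have "(dist x (r y))\<^sup>2 < (len z / 4)\<^sup>2" by (simp add: c_def power_divide algebra_simps)
      then have "dist x (r y) < len z / 4" by (rule power2_less_imp_less) (use lz in simp)
      moreover have "dist x y \<le> dist x (r y) + len y"
        using dist_triangle2[of x y "r y"] by (simp add: len_def)
      moreover have "len z \<le> dist x z" using len_le_dist'[of x z] x zQ by auto
      moreover have "len y \<le> dist y z" using len_le_dist[of y z] yQ zQ neq by auto
      ultimately show "dist x y - dist x z / 2 \<le> dist y z" using lz by argo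
    qed
  qed
  with \<open>real k \<le> loglog R\<close> show ?thesis by simp
qed

text \<open>Links shorter than \<open>32 * N\<^sup>2 * len x\<close> and longer links with a
  conflicting receiver are counted, each contributing at most 1. For the others the base is at most
  \<open>1 / N\<^sup>2\<close>, so each contributes at most \<open>1 / N\<close>, and together at
  most 1.\<close>

lemma sum_capped_affectance_near:
  assumes "2 < \<alpha>" and x: "x \<in> Q" and N: "1 \<le> N" "real (card Q) \<le> N"
    and R: "\<And>y. y \<in> Q \<Longrightarrow> len y \<le> R * len x"
  shows "(\<Sum>y | y \<in> Q - {x} \<and> dist x (r y) < dist x y / 2. capped_affectance \<alpha> x y)
    \<le> 81 * (log 2 (32 * N\<^sup>2) + 2) + 25 * (loglog R + 1) + 1"
proof -
  let ?Y = "{y. y \<in> Q - {x} \<and> dist x (r y) < dist x y / 2}"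
  let ?A = "{y \<in> Q - {x}. dist x (r y) < dist x y / 2 \<and> len y < 32 * N\<^sup>2 * len x}"
  let ?B = "{y \<in> Q - {x}. (dist x (r y))\<^sup>2 < N\<^sup>2 * len x * len y \<and> 32 * N\<^sup>2 * len x \<le> len y}"
  have finY: "finite ?Y" using finite_Q by auto
  have lx: "0 < len x" using x by (rule len_pos)
  have N2: "1 \<le> N\<^sup>2" "N \<le> N\<^sup>2" using N(1) by (auto intro: self_le_power)
  have pw: "capped_affectance \<alpha> x y \<le> (if y \<in> ?A then 1 else 0) + (if y \<in> ?B then 1 else 0) + 1 / N"
    if y: "y \<in> ?Y" for y
  proof (cases "y \<in> ?A \<or> y \<in> ?B")
    case True
    then show ?thesis using N(1) by (auto intro: order_trans[OF capped_affectance_le_1])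
  next
    case False
    have ly: "0 < len y" using y len_pos by auto
    have far: "N\<^sup>2 * (len x * len y) \<le> (dist x (r y))\<^sup>2" using False y by (auto simp: not_less ac_simps)
    have pos: "0 < N\<^sup>2 * (len x * len y)" using lx ly N2 by (intro mult_pos_pos) linarith+
    have neq: "x \<noteq> r y" using far pos by auto
    let ?t = "len x * len y / (dist x (r y))\<^sup>2"
    have d: "0 < (dist x (r y))\<^sup>2" using neq by simp
    have t0: "0 \<le> ?t" using lx ly by simp
    have "?t \<le> 1 / N\<^sup>2" using far d N(1) by (simp add: divide_simps ac_simps)
    also have "\<dots> \<le> 1 / N" using N(1) N2 by (intro divide_left_mono) auto
    finally have t: "?t \<le> 1 / N" .
    also have "1 / N \<le> 1" using N by simp
    finally have t1: "?t \<le> 1" .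
    have "capped_affectance \<alpha> x y \<le> ?t powr (\<alpha> / 2)" using neq by (simp add: capped_affectance_def)
    also have "\<dots> \<le> ?t powr 1" using t0 t1 assms(1) by (intro powr_mono') auto
    also have "\<dots> = ?t" using t0 by (rule powr_one)
    finally show ?thesis using False t by auto
  qed
  have "(\<Sum>y\<in>?Y. capped_affectance \<alpha> x y)
      \<le> (\<Sum>y\<in>?Y. (if y \<in> ?A then 1 else 0) + (if y \<in> ?B then 1 else 0) + 1 / N)"
    by (rule sum_mono) (rule pw)
  also have "\<dots> = real (card (?Y \<inter> ?A)) + real (card (?Y \<inter> ?B)) + real (card ?Y) / N"
    using finY by (simp only: sum.distrib sum.inter_restrict[symmetric]) simp
  also have "\<dots> \<le> real (card ?A) + real (card ?B) + 1"
  proof -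
    have "card ?Y \<le> card Q" using finite_Q by (intro card_mono) auto
    then have "real (card ?Y) / N \<le> 1" using N by (simp add: pos_divide_le_eq)
    moreover have "card (?Y \<inter> ?A) \<le> card ?A" "card (?Y \<inter> ?B) \<le> card ?B"
      using finite_Q by (auto intro!: card_mono)
    ultimately show ?thesis by linarith
  qed
  also have "\<dots> \<le> 81 * (log 2 (32 * N\<^sup>2) + 2) + 25 * (loglog R + 1) + 1"
    using card_near_receiver_moderate[OF x, of "32 * N\<^sup>2"] card_near_receiver_conflicting[OF x N(1) R] N2
    by linarith
  finally show ?thesis .
qed

text \<open>If \<open>r y\<close> is not near \<open>x\<close>, then \<open>dist x y\<close> may
  replace \<open>dist x (r y)\<close> at the cost of a factor 4. The resulting bound
  \<open>g\<close> is symmetric, so both orders of a pair can be charged to its shorter link, hence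
  the factor 2. The near pairs are bounded separately for each \<open>x\<close>.\<close>

lemma sum_capped_affectance:
  assumes "2 < \<alpha>" and N: "1 \<le> N" "real (card Q) \<le> N"
    and R: "\<And>x y. x \<in> Q \<Longrightarrow> y \<in> Q \<Longrightarrow> len y \<le> R * len x"
  shows "(\<Sum>x\<in>Q. \<Sum>y\<in>Q - {x}. capped_affectance \<alpha> x y)
    \<le> real (card Q) * (2 * (36 * 2 powr \<alpha> / (1 - 2 powr - (min \<alpha> 4 - 2)))
        + (81 * (log 2 (32 * N\<^sup>2) + 2) + 25 * (loglog R + 1) + 1))"
proof -
  let ?F = "36 * 2 powr \<alpha> / (1 - 2 powr - (min \<alpha> 4 - 2))"
  let ?G = "81 * (log 2 (32 * N\<^sup>2) + 2) + 25 * (loglog R + 1) + 1"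
  let ?near = "\<lambda>x y. dist x (r y) < dist x y / 2"
  define g where "g x y = (4 * (len x * len y / (dist x y)\<^sup>2)) powr (\<alpha> / 2)" for x y
  define h where "h x y = (if y \<in> Q - {x} \<and> len x \<le> len y then g x y else 0)" for x y
  have g_sym: "g x y = g y x" for x y by (simp add: g_def dist_commute mult.commute)
  have g_nonneg: "0 \<le> g x y" for x y by (simp add: g_def)
  have h_nonneg: "0 \<le> h x y" for x y by (simp add: h_def g_nonneg)
  have pw: "capped_affectance \<alpha> x y \<le> (h x y + h y x) + (if ?near x y then capped_affectance \<alpha> x y else 0)"
    if x: "x \<in> Q" and y: "y \<in> Q - {x}" for x y
  proof (cases "?near x y")
    case True
    then show ?thesis using h_nonneg[of x y] h_nonneg[of y x] by simp
  next
    case False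
    have d: "0 < dist x y" using y by auto
    with False have neq: "x \<noteq> r y" and d': "dist x y / 2 \<le> dist x (r y)" by auto
    have pos: "0 < len x" "0 < len y" using x y len_pos by auto
    have "(dist x y)\<^sup>2 / 4 \<le> (dist x (r y))\<^sup>2"
      using power_mono[OF d', of 2] by (simp add: power_divide)
    then have "len x * len y / (dist x (r y))\<^sup>2 \<le> len x * len y / ((dist x y)\<^sup>2 / 4)"
      using pos d neq by (intro divide_left_mono) auto
    then have "(len x * len y / (dist x (r y))\<^sup>2) powr (\<alpha> / 2) \<le> g x y"
      unfolding g_def using pos assms(1) by (intro powr_mono2) (auto simp: field_simps)
    then have "capped_affectance \<alpha> x y \<le> g x y" using neq by (simp add: capped_affectance_def)
    also have "g x y \<le> h x y + h y x"
      using x y g_nonneg[of x y] g_sym[of x y] by (auto simp: h_def)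
    finally show ?thesis using False by simp
  qed
  have near: "(\<Sum>y\<in>Q - {x}. if ?near x y then capped_affectance \<alpha> x y else 0) \<le> ?G" if x: "x \<in> Q" for x
  proof -
    have "(\<Sum>y\<in>Q - {x}. if ?near x y then capped_affectance \<alpha> x y else 0)
        = (\<Sum>y | y \<in> Q - {x} \<and> ?near x y. capped_affectance \<alpha> x y)"
      using finite_Q by (subst sum.inter_filter[symmetric]) auto
    also have "\<dots> \<le> ?G" using sum_capped_affectance_near[OF assms(1) x N R[OF x]] .
    finally show ?thesis .
  qed
  have longer: "(\<Sum>y\<in>Q. h x y) \<le> ?F" if x: "x \<in> Q" for x
  proof -
    have "(\<Sum>y\<in>Q. h x y) = (\<Sum>y | y \<in> Q \<and> (y \<in> Q - {x} \<and> len x \<le> len y). g x y)"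
      unfolding h_def by (rule sum.inter_filter[OF finite_Q, symmetric])
    also have "{y. y \<in> Q \<and> (y \<in> Q - {x} \<and> len x \<le> len y)} = {y. y \<in> Q - {x} \<and> len x \<le> len y}" by auto
    also have "(\<Sum>y | y \<in> Q - {x} \<and> len x \<le> len y. g x y) \<le> ?F"
      unfolding g_def by (rule sum_affectance_longer[OF assms(1) x])
    finally show ?thesis .
  qed
  have "(\<Sum>x\<in>Q. \<Sum>y\<in>Q - {x}. capped_affectance \<alpha> x y)
      \<le> (\<Sum>x\<in>Q. \<Sum>y\<in>Q - {x}. (h x y + h y x) + (if ?near x y then capped_affectance \<alpha> x y else 0))"
    by (intro sum_mono pw)
  also have "\<dots> = (\<Sum>x\<in>Q. \<Sum>y\<in>Q - {x}. h x y + h y x)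
      + (\<Sum>x\<in>Q. \<Sum>y\<in>Q - {x}. if ?near x y then capped_affectance \<alpha> x y else 0)"
    by (simp only: sum.distrib)
  also have "\<dots> \<le> (\<Sum>x\<in>Q. \<Sum>y\<in>Q. h x y + h y x) + (\<Sum>x\<in>Q. ?G)"
  proof (rule add_mono)
    show "(\<Sum>x\<in>Q. \<Sum>y\<in>Q - {x}. h x y + h y x) \<le> (\<Sum>x\<in>Q. \<Sum>y\<in>Q. h x y + h y x)"
      by (intro sum_mono sum_mono2) (use finite_Q h_nonneg in \<open>auto intro: add_nonneg_nonneg\<close>)
  qed (intro sum_mono near)
  also have "(\<Sum>x\<in>Q. \<Sum>y\<in>Q. h x y + h y x) = (\<Sum>x\<in>Q. \<Sum>y\<in>Q. h x y) + (\<Sum>y\<in>Q. \<Sum>x\<in>Q. h y x)"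
    unfolding sum.distrib by (intro arg_cong2[of _ _ _ _ "(+)"] refl sum.swap)
  also have "\<dots> \<le> (\<Sum>x\<in>Q. ?F) + (\<Sum>x\<in>Q. ?F)" by (intro add_mono sum_mono longer)
  finally show ?thesis by (simp add: algebra_simps)
qed

end

section \<open>Feasible sets\<close>

text \<open>Under mean power, interference divided by signal at \<open>g x\<close> is the sum in
  \<open>aff\<close>. Indexing the links by points lets the lemma serve both orientations.\<close>

lemma feasible_image:
  assumes "0 < \<beta>" and fin: "finite A" and inj: "inj_on g A"
    and len: "\<And>x. x \<in> A \<Longrightarrow> 0 < link_length (g x)"
    and dst: "\<And>x y. x \<in> A \<Longrightarrow> y \<in> A \<Longrightarrow> y \<noteq> x \<Longrightarrow> 0 < link_dist (g y) (g x)"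
    and aff: "\<And>x. x \<in> A \<Longrightarrow> (\<Sum>y\<in>A - {x}.
        (link_length (g y) * link_length (g x) / (link_dist (g y) (g x))\<^sup>2) powr (\<alpha> / 2)) \<le> 1 / \<beta>"
  shows "feasible \<alpha> \<beta> (mean_power \<alpha>) (g ` A)"
  unfolding feasible_def
proof
  fix l assume "l \<in> g ` A"
  then obtain x where x: "x \<in> A" and l: "l = g x" by blast
  let ?a = "link_length (g x)"
  define i where "i y = link_length (g y) powr (\<alpha> / 2) / link_dist (g y) (g x) powr \<alpha>" for y
  define I where "I = (\<Sum>y\<in>A - {x}. i y)"
  have a: "0 < ?a" using len[OF x] .
  have half: "(d\<^sup>2) powr (\<alpha> / 2) = d powr \<alpha>" if "0 < d" for d :: real
  proof -
    have "(d\<^sup>2) powr (\<alpha> / 2) = (d powr 2) powr (\<alpha> / 2)" using that by (subst powr_numeral) auto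
    then show ?thesis by (simp add: powr_powr)
  qed
  have "g ` A - {l} = g ` (A - {x})" using inj x l by (auto dest: inj_onD)
  then have "(\<Sum>l'\<in>g ` A - {l}. ennreal (mean_power \<alpha> l') / ennreal (link_dist l' l powr \<alpha>))
      = (\<Sum>y\<in>A - {x}. ennreal (mean_power \<alpha> (g y)) / ennreal (link_dist (g y) l powr \<alpha>))"
    using inj by (simp add: sum.reindex inj_on_diff)
  also have "\<dots> = (\<Sum>y\<in>A - {x}. ennreal (i y))"
  proof (rule sum.cong)
    fix y assume "y \<in> A - {x}"
    then show "ennreal (mean_power \<alpha> (g y)) / ennreal (link_dist (g y) l powr \<alpha>) = ennreal (i y)"
      using dst[OF x, of y] unfolding l by (subst divide_ennreal) (auto simp: mean_power_def i_def)
  qed simp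
  also have "\<dots> = ennreal I" unfolding I_def by (rule sum_ennreal) (simp add: i_def)
  finally have interference: "(\<Sum>l'\<in>g ` A - {l}. ennreal (mean_power \<alpha> l') / ennreal (link_dist l' l powr \<alpha>)) = ennreal I" .
  have signal: "ennreal (mean_power \<alpha> l) / ennreal (link_length l powr \<alpha>) = ennreal (1 / ?a powr (\<alpha> / 2))"
  proof -
    have "?a powr \<alpha> = ?a powr (\<alpha> / 2) * ?a powr (\<alpha> / 2)" by (simp flip: powr_add)
    then show ?thesis using a by (subst divide_ennreal) (auto simp: l mean_power_def)
  qed
  \<comment> \<open>The signal is \<open>1 / ?a powr (\<alpha> / 2)\<close>, so this product is
    interference over signal.\<close>
  have "?a powr (\<alpha> / 2) * I = (\<Sum>y\<in>A - {x}. (link_length (g y) * ?a / (link_dist (g y) (g x))\<^sup>2) powr (\<alpha> / 2))"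
    unfolding I_def sum_distrib_left
  proof (rule sum.cong)
    fix y assume y: "y \<in> A - {x}"
    then have "0 < link_length (g y)" "0 < link_dist (g y) (g x)" using len dst x by auto
    then show "?a powr (\<alpha> / 2) * i y = (link_length (g y) * ?a / (link_dist (g y) (g x))\<^sup>2) powr (\<alpha> / 2)"
      using a by (simp add: i_def powr_divide powr_mult half)
  qed simp
  also have "\<dots> \<le> 1 / \<beta>" by (rule aff[OF x])
  finally have bound: "?a powr (\<alpha> / 2) * I \<le> 1 / \<beta>" .
  have I0: "0 \<le> I" unfolding I_def by (intro sum_nonneg) (simp add: i_def)
  show "ennreal \<beta> \<le> sir \<alpha> (mean_power \<alpha>) (g ` A) l"
  proof (cases "I = 0")
    \<comment> \<open>Without interference, the positive signal divided by 0 is infinite in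
      \<open>ennreal\<close>.\<close>
    case True
    then show ?thesis unfolding sir_def interference signal using a by simp
  next
    case False
    then have "0 < I" using I0 by simp
    then have "\<beta> \<le> 1 / ?a powr (\<alpha> / 2) / I"
      using bound a \<open>0 < \<beta>\<close> by (simp add: field_simps)
    then show ?thesis unfolding sir_def interference signal
      using \<open>0 < I\<close> by (subst divide_ennreal) (auto intro: ennreal_leI)
  qed
qed

lemma ennreal_inverse_antimono: "a \<le> b \<Longrightarrow> inverse b \<le> inverse a" for a b :: ennreal
  by (simp add: less_eq_ennreal.rep_eq inverse_ennreal.rep_eq ereal_inverse_antimono)

text \<open>Dropping links can only lower the interference at those that remain.\<close>

lemma feasible_subset:
  assumes "feasible \<alpha> \<beta> pow S" "S' \<subseteq> S" "finite S"
  shows "feasible \<alpha> \<beta> pow S'"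
  unfolding feasible_def
proof
  fix l assume l: "l \<in> S'"
  have "(\<Sum>l'\<in>S' - {l}. ennreal (pow l') / ennreal (link_dist l' l powr \<alpha>))
      \<le> (\<Sum>l'\<in>S - {l}. ennreal (pow l') / ennreal (link_dist l' l powr \<alpha>))"
    using assms by (intro sum_mono2) auto
  then have "sir \<alpha> pow S l \<le> sir \<alpha> pow S' l"
    unfolding sir_def divide_ennreal_def by (intro mult_left_mono ennreal_inverse_antimono) auto
  then show "ennreal \<beta> \<le> sir \<alpha> pow S' l"
    using assms(1,2) l by (auto simp: feasible_def intro: order_trans)
qed

text \<open>Overlapping slots become disjoint when each link is assigned to one slot containing it;
  the parts stay feasible by \<open>feasible_subset\<close>.\<close>

lemma strongly_connectable_cover:
  assumes "strongly_connects (\<Union>\<S>) P" "finite P" "finite \<S>"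
    and feas: "\<And>S. S \<in> \<S> \<Longrightarrow> feasible \<alpha> \<beta> pow S"
  shows "\<exists>k\<le>card \<S>. strongly_connectable \<alpha> \<beta> pow P k"
proof -
  let ?L = "\<Union>\<S>"
  define f where "f l = (SOME S. S \<in> \<S> \<and> l \<in> S)" for l
  have f: "f l \<in> \<S> \<and> l \<in> f l" if "l \<in> ?L" for l
    unfolding f_def by (rule someI_ex) (use that in auto)
  \<comment> \<open>A partition has no empty blocks, so slots that receive no link are dropped;
    hence only an upper bound on \<open>k\<close>.\<close>
  define \<T> where "\<T> = (\<lambda>S. {l \<in> ?L. f l = S}) ` \<S> - {{}}"
  have "?L \<subseteq> P \<times> P" using assms(1) by (simp add: strongly_connects_def)
  then have finL: "finite ?L" using assms(2) by (meson finite_SigmaI finite_subset)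
  have "partition_on ?L \<T>"
  proof (rule partition_onI)
    show "\<Union>\<T> = ?L"
    proof (intro equalityI subsetI)
      fix l assume l: "l \<in> ?L"
      then have "{l' \<in> ?L. f l' = f l} \<in> \<T>" unfolding \<T>_def using f[OF l] by blast
      with l show "l \<in> \<Union>\<T>" by blast
    qed (auto simp: \<T>_def)
  qed (auto simp: \<T>_def disjnt_def)
  moreover have "finite \<T>" unfolding \<T>_def using assms(3) by simp
  moreover have "feasible \<alpha> \<beta> pow T" if "T \<in> \<T>" for T
  proof -
    obtain S where S: "S \<in> \<S>" "T = {l \<in> ?L. f l = S}" using \<open>T \<in> \<T>\<close> unfolding \<T>_def by blast
    have "T \<subseteq> S" using f S by auto
    moreover have "finite S" by (rule finite_subset[OF Union_upper[OF S(1)] finL])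
    ultimately show ?thesis using feasible_subset[OF feas[OF S(1)]] by blast
  qed
  moreover have "card \<T> \<le> card \<S>"
    unfolding \<T>_def by (rule order_trans[OF card_Diff1_le card_image_le[OF assms(3)]])
  ultimately show ?thesis using assms(1) unfolding strongly_connectable_def by blast
qed

text \<open>A uniformly random colouring has expected monochromatic cost \<open>1 / K\<close> of the
  total. A greedy choice replaces chance: each new element takes a colour whose added cost is at
  most the average over the \<open>K\<close> colours.\<close>

lemma ex_low_cost_colouring:
  fixes b :: "'a \<Rightarrow> 'a \<Rightarrow> real"
  assumes "finite F" "0 < K"
  shows "\<exists>f. (\<forall>x. f x < K) \<and>
    (\<Sum>x\<in>F. \<Sum>y | y \<in> F - {x} \<and> f y = f x. b x y) \<le> (\<Sum>x\<in>F. \<Sum>y\<in>F - {x}. b x y) / real K"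
  using \<open>finite F\<close>
proof (induction F rule: finite_induct)
  case empty
  then show ?case using \<open>0 < K\<close> by (intro exI[of _ "\<lambda>_. 0"]) auto
next
  case (insert z F)
  then obtain f where f: "\<And>x. f x < K" and
    IH: "(\<Sum>x\<in>F. \<Sum>y | y \<in> F - {x} \<and> f y = f x. b x y) \<le> (\<Sum>x\<in>F. \<Sum>y\<in>F - {x}. b x y) / real K"
    by blast
  define w where "w y = b z y + b y z" for y
  have "\<exists>c<K. (\<Sum>y | y \<in> F \<and> f y = c. w y) \<le> (\<Sum>y\<in>F. w y) / real K"
  proof (rule ccontr)
    assume "\<not> ?thesis"
    then have "(\<Sum>c<K. (\<Sum>y\<in>F. w y) / real K) < (\<Sum>c<K. \<Sum>y | y \<in> F \<and> f y = c. w y)"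
      using \<open>0 < K\<close> by (intro sum_strict_mono) (auto simp: not_le)
    also have "\<dots> = (\<Sum>y\<in>F. w y)"
      by (rule sum.group) (use insert f in auto)
    finally show False using \<open>0 < K\<close> by simp
  qed
  then obtain c where c: "c < K" "(\<Sum>y | y \<in> F \<and> f y = c. w y) \<le> (\<Sum>y\<in>F. w y) / real K" by blast
  define f' where "f' = f(z := c)"
  have f'_F: "f' y = f y" if "y \<in> F" for y using that insert by (auto simp: f'_def)
  have f'_z: "f' z = c" by (simp add: f'_def)
  \<comment> \<open>Stated for any symmetric \<open>P\<close> to be used twice: with equality of
    colours, and with \<open>True\<close> for the total cost.\<close>
  have split: "(\<Sum>x\<in>insert z F. \<Sum>y | y \<in> insert z F - {x} \<and> P x y. b x y) =
      (\<Sum>x\<in>F. \<Sum>y | y \<in> F - {x} \<and> P x y. b x y) + (\<Sum>y | y \<in> F \<and> P y z. w y)"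
    if sym: "\<And>x y. P x y = P y x" for P
  proof -
    have 1: "(\<Sum>y | y \<in> insert z F - {x} \<and> P x y. b x y) =
        (\<Sum>y | y \<in> F - {x} \<and> P x y. b x y) + (if P x z then b x z else 0)" if "x \<in> F" for x
    proof -
      have "{y. y \<in> insert z F - {x} \<and> P x y} =
          {y. y \<in> F - {x} \<and> P x y} \<union> (if P x z then {z} else {})"
        using that insert.hyps by auto
      then show ?thesis using insert.hyps that by (simp add: sum.union_disjoint)
    qed
    have 2: "{y. y \<in> insert z F - {z} \<and> P z y} = {y. y \<in> F \<and> P y z}"
      using insert.hyps sym by auto
    have 3: "(\<Sum>x\<in>F. if P x z then b x z else 0) = (\<Sum>y | y \<in> F \<and> P y z. b y z)"
      using insert.hyps by (subst sum.inter_filter[symmetric]) auto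
    have "(\<Sum>x\<in>F. \<Sum>y | y \<in> insert z F - {x} \<and> P x y. b x y) =
        (\<Sum>x\<in>F. \<Sum>y | y \<in> F - {x} \<and> P x y. b x y) + (\<Sum>y | y \<in> F \<and> P y z. b y z)"
      unfolding 3[symmetric] sum.distrib[symmetric] by (intro sum.cong refl 1)
    then show ?thesis unfolding sum.insert[OF insert.hyps] 2 w_def sum.distrib by linarith
  qed
  have "(\<Sum>x\<in>insert z F. \<Sum>y | y \<in> insert z F - {x} \<and> f' y = f' x. b x y) =
      (\<Sum>x\<in>F. \<Sum>y | y \<in> F - {x} \<and> f' y = f' x. b x y) + (\<Sum>y | y \<in> F \<and> f' z = f' y. w y)"
    by (rule split) auto
  also have "(\<Sum>x\<in>F. \<Sum>y | y \<in> F - {x} \<and> f' y = f' x. b x y) =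
      (\<Sum>x\<in>F. \<Sum>y | y \<in> F - {x} \<and> f y = f x. b x y)"
    by (intro sum.cong refl) (auto simp: f'_F)
  also have "(\<Sum>y | y \<in> F \<and> f' z = f' y. w y) = (\<Sum>y | y \<in> F \<and> f y = c. w y)"
    by (intro sum.cong) (auto simp: f'_F f'_z)
  also have "(\<Sum>x\<in>F. \<Sum>y | y \<in> F - {x} \<and> f y = f x. b x y) + (\<Sum>y | y \<in> F \<and> f y = c. w y) \<le>
      ((\<Sum>x\<in>F. \<Sum>y\<in>F - {x}. b x y) + (\<Sum>y\<in>F. w y)) / real K"
    using IH c(2) by (simp add: add_divide_distrib)
  also have "(\<Sum>x\<in>F. \<Sum>y\<in>F - {x}. b x y) + (\<Sum>y\<in>F. w y) =
      (\<Sum>x\<in>insert z F. \<Sum>y\<in>insert z F - {x}. b x y)"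
    using split[of "\<lambda>_ _. True"] by (simp add: set_diff_eq)
  finally show ?case using f c(1) by (intro exI[of _ f']) (auto simp: f'_def)
qed

section \<open>Selecting the links of one round\<close>

context nearest_neighbours begin

text \<open>Within a colour, \<open>In x\<close> bounds the affectance on \<open>(x, r x)\<close>
  and \<open>Out x\<close> that on \<open>(r x, x)\<close>. By Markov's inequality at most half of
  the points have \<open>In x + Out x\<close> at least \<open>1 / \<beta>\<close>; excluding cycles
  costs another half, hence \<open>card Q / 4\<close>. Each colour gives one slot per orientation.
  The map \<open>\<mu>\<close> certifies that iterating \<open>r\<close> leaves
  \<open>D\<close>.\<close>

lemma ex_feasible_links:
  assumes "1 \<le> \<beta>" "0 < K"
    and W: "(\<Sum>x\<in>Q. \<Sum>y\<in>Q - {x}. capped_affectance \<alpha> x y) \<le> real (card Q) * W"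
    and K: "4 * \<beta> * W \<le> real K"
  obtains D \<S> and \<mu> :: "point \<Rightarrow> nat"
  where "D \<subseteq> Q" "finite \<S>" "card \<S> \<le> 2 * K"
    "\<Union>\<S> = (\<lambda>x. (x, r x)) ` D \<union> (\<lambda>x. (r x, x)) ` D"
    "\<And>S. S \<in> \<S> \<Longrightarrow> feasible \<alpha> \<beta> (mean_power \<alpha>) S"
    "real (card Q) / 4 \<le> real (card D)"
    "\<And>x. x \<in> D \<Longrightarrow> \<mu> (r x) < \<mu> x"
proof -
  let ?b = "capped_affectance \<alpha>"
  obtain f where f: "\<And>x. f x < K" and
    cost: "(\<Sum>x\<in>Q. \<Sum>y | y \<in> Q - {x} \<and> f y = f x. ?b x y) \<le> (\<Sum>x\<in>Q. \<Sum>y\<in>Q - {x}. ?b x y) / real K"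
    using ex_low_cost_colouring[OF finite_Q \<open>0 < K\<close>, of ?b] by blast
  define Out where "Out x = (\<Sum>y | y \<in> Q - {x} \<and> f y = f x. ?b x y)" for x
  define In where "In x = (\<Sum>y | y \<in> Q - {x} \<and> f y = f x. ?b y x)" for x
  have nonneg: "0 \<le> In x" "0 \<le> Out x" for x
    by (auto simp: In_def Out_def intro!: sum_nonneg capped_affectance_nonneg)
  have other: "{y. y \<in> Q - {x} \<and> f y = f x} = {y \<in> Q. y \<noteq> x \<and> f y = f x}" for x by auto
  have "(\<Sum>x\<in>Q. In x) = (\<Sum>x\<in>Q. \<Sum>y\<in>Q. if y \<noteq> x \<and> f y = f x then ?b y x else 0)"
    by (simp only: In_def other sum.inter_filter[OF finite_Q])
  also have "\<dots> = (\<Sum>y\<in>Q. \<Sum>x\<in>Q. if y \<noteq> x \<and> f y = f x then ?b y x else 0)" by (rule sum.swap)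
  also have "\<dots> = (\<Sum>x\<in>Q. Out x)"
    unfolding Out_def other sum.inter_filter[OF finite_Q] by (intro sum.cong refl) auto
  finally have "(\<Sum>x\<in>Q. In x + Out x) = 2 * (\<Sum>x\<in>Q. Out x)" by (simp add: sum.distrib)
  also have "\<dots> \<le> 2 * (real (card Q) * W / real K)"
    using order_trans[OF cost divide_right_mono[OF W]] by (simp add: Out_def)
  \<comment> \<open>The 4 in the assumption on \<open>K\<close> is 2 for adding \<open>In\<close> to
    \<open>Out\<close> times 2 for Markov's inequality.\<close>
  also have "\<dots> \<le> real (card Q) / (2 * \<beta>)"
    using mult_left_mono[OF K, of "real (card Q)"] assms(1,2) by (simp add: field_simps)
  finally have total: "(\<Sum>x\<in>Q. In x + Out x) \<le> real (card Q) / (2 * \<beta>)" .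
  define B where "B = {x \<in> Q. 1 / \<beta> \<le> In x + Out x}"
  have "real (card B) * (1 / \<beta>) \<le> (\<Sum>x\<in>B. In x + Out x)"
    using sum_bounded_below[of B "1 / \<beta>" "\<lambda>x. In x + Out x"] by (simp add: B_def)
  also have "\<dots> \<le> (\<Sum>x\<in>Q. In x + Out x)"
    using finite_Q nonneg by (intro sum_mono2) (auto simp: B_def)
  finally have "real (card B) * (1 / \<beta>) \<le> real (card Q) / (2 * \<beta>)" using total by linarith
  then have cardB: "real (card B) \<le> real (card Q) / 2" using assms(1) by (simp add: field_simps)
  define G where "G = Q - B"
  have "card G = card Q - card B" "card B \<le> card Q"
    unfolding G_def using finite_Q by (auto simp: B_def intro!: card_Diff_subset card_mono)
  then have cardG: "real (card Q) / 2 \<le> real (card G)" using cardB by linarith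
  have G: "In x < 1 / \<beta>" "Out x < 1 / \<beta>" if "x \<in> G" for x
    using that nonneg[of x] by (auto simp: G_def B_def)
  obtain idx :: "point \<Rightarrow> nat" and m where idx: "idx ` Q = {i. i < m}" "inj_on idx Q"
    using finite_imp_inj_to_nat_seg[OF finite_Q] by blast
  txt \<open>
    Along an injective numbering every link goes up or down; keeping only the more frequent
    direction rules out cycles, so that the senders can be dropped.
  \<close>
  have "\<exists>D\<subseteq>G. \<exists>\<mu>::point \<Rightarrow> nat. real (card G) / 2 \<le> real (card D) \<and> (\<forall>x\<in>D. \<mu> (r x) < \<mu> x)"
  proof -
    let ?D1 = "{x \<in> G. idx (r x) < idx x}" and ?D2 = "{x \<in> G. idx x < idx (r x)}"
    have finG: "finite G" using finite_Q by (simp add: G_def)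
    have "G \<subseteq> ?D1 \<union> ?D2"
    proof
      fix x assume x: "x \<in> G"
      then have "idx (r x) \<noteq> idx x" using idx(2) r_in[of x] r_neq[of x] by (auto simp: G_def dest: inj_onD)
      then show "x \<in> ?D1 \<union> ?D2" using x by auto
    qed
    then have "card G \<le> card (?D1 \<union> ?D2)" using finG by (intro card_mono) auto
    also have "\<dots> \<le> card ?D1 + card ?D2" by (rule card_Un_le)
    finally have "real (card G) / 2 \<le> real (card ?D1) \<or> real (card G) / 2 \<le> real (card ?D2)" by linarith
    then show ?thesis
    proof
      assume "real (card G) / 2 \<le> real (card ?D1)"
      then show ?thesis by (intro exI[of _ ?D1] conjI exI[of _ idx]) auto
    next
      assume *: "real (card G) / 2 \<le> real (card ?D2)"
      \<comment> \<open>All numbers are below \<open>m\<close>, so subtracting from \<open>m\<close>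
        reverses their order without truncation at 0.\<close>
      have "idx x < m" if "x \<in> Q" for x using idx(1) that by auto
      then have "\<forall>x\<in>?D2. m - idx (r x) < m - idx x" using r_in by (auto simp: G_def intro: diff_less_mono2)
      with * show ?thesis by (intro exI[of _ ?D2] conjI exI[of _ "\<lambda>x. m - idx x"]) auto
    qed
  qed
  then obtain D and \<mu> :: "point \<Rightarrow> nat" where D: "D \<subseteq> G" "real (card G) / 2 \<le> real (card D)"
    and \<mu>: "\<And>x. x \<in> D \<Longrightarrow> \<mu> (r x) < \<mu> x" by blast
  let ?A = "\<lambda>c. {x \<in> D. f x = c}"
  have DQ: "D \<subseteq> Q" using D(1) by (auto simp: G_def)
  have finA: "finite (?A c)" for c using DQ finite_Q by (auto intro: finite_subset)
  \<comment> \<open>A value strictly below 1 is neither capped nor the default for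
    \<open>x = r y\<close>. Since \<open>1 / \<beta> \<le> 1\<close>, all pairs of one colour in
    \<open>D\<close> have such values.\<close>
  have uncapped: "x \<noteq> r y \<and> ?b x y = (len x * len y / (dist x (r y))\<^sup>2) powr (\<alpha> / 2)"
    if "?b x y < 1" for x y
    using that by (auto simp: capped_affectance_def min_def split: if_splits)
  have inv: "1 / \<beta> \<le> 1" using assms(1) by simp
  have member: "?b x y \<le> In y" "?b x y \<le> Out x" if "x \<in> Q" "y \<in> Q" "x \<noteq> y" "f x = f y" for x y
    unfolding In_def Out_def using that finite_Q
    by (auto intro!: member_le_sum[where f = "\<lambda>z. ?b z y"] member_le_sum[where f = "?b x"] capped_affectance_nonneg)
  have small: "?b x y < 1" if "x \<in> ?A c" "y \<in> ?A c" "x \<noteq> y" for x y c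
    using member[of x y] G(1)[of y] that D(1) DQ inv by fastforce
  have fwd: "feasible \<alpha> \<beta> (mean_power \<alpha>) ((\<lambda>x. (x, r x)) ` ?A c)" for c
  proof (rule feasible_image)
    fix x assume x: "x \<in> ?A c"
    then show "0 < link_length (x, r x)" using DQ len_pos[of x] by (auto simp: link_length_def len_def)
    have "(\<Sum>y\<in>?A c - {x}. (link_length (y, r y) * link_length (x, r x) / (link_dist (y, r y) (x, r x))\<^sup>2) powr (\<alpha> / 2))
        = (\<Sum>y\<in>?A c - {x}. ?b y x)"
      using small x uncapped by (intro sum.cong refl) (force simp: link_length_def link_dist_def len_def)
    also have "\<dots> \<le> In x" unfolding In_def
      by (rule sum_mono2) (use x DQ finite_Q capped_affectance_nonneg in auto)
    finally show "(\<Sum>y\<in>?A c - {x}. (link_length (y, r y) * link_length (x, r x) / (link_dist (y, r y) (x, r x))\<^sup>2) powr (\<alpha> / 2)) \<le> 1 / \<beta>"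
      using G(1)[of x] x D(1) by auto
  next
    fix x y assume "x \<in> ?A c" "y \<in> ?A c" "y \<noteq> x"
    then show "0 < link_dist (y, r y) (x, r x)" using uncapped[OF small[of y c x]] by (simp add: link_dist_def)
  qed (use assms(1) finA in \<open>auto simp: inj_on_def\<close>)
  have bwd: "feasible \<alpha> \<beta> (mean_power \<alpha>) ((\<lambda>x. (r x, x)) ` ?A c)" for c
  proof (rule feasible_image)
    fix x assume x: "x \<in> ?A c"
    then show "0 < link_length (r x, x)" using DQ len_pos[of x] by (auto simp: link_length_def len_def)
    have "(\<Sum>y\<in>?A c - {x}. (link_length (r y, y) * link_length (r x, x) / (link_dist (r y, y) (r x, x))\<^sup>2) powr (\<alpha> / 2))
        = (\<Sum>y\<in>?A c - {x}. ?b x y)"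
    proof (rule sum.cong)
      fix y assume y: "y \<in> ?A c - {x}"
      then have "?b x y = (len x * len y / (dist x (r y))\<^sup>2) powr (\<alpha> / 2)" using uncapped[OF small[of x c y]] x by auto
      then show "(link_length (r y, y) * link_length (r x, x) / (link_dist (r y, y) (r x, x))\<^sup>2) powr (\<alpha> / 2) = ?b x y"
        by (simp add: link_length_def link_dist_def len_def dist_commute mult.commute)
    qed simp
    also have "\<dots> \<le> Out x" unfolding Out_def
      by (rule sum_mono2) (use x DQ finite_Q capped_affectance_nonneg in auto)
    finally show "(\<Sum>y\<in>?A c - {x}. (link_length (r y, y) * link_length (r x, x) / (link_dist (r y, y) (r x, x))\<^sup>2) powr (\<alpha> / 2)) \<le> 1 / \<beta>"
      using G(2)[of x] x D(1) by auto
  next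
    fix x y assume "x \<in> ?A c" "y \<in> ?A c" "y \<noteq> x"
    then show "0 < link_dist (r y, y) (r x, x)" using uncapped[OF small[of x c y]] by (auto simp: link_dist_def)
  qed (use assms(1) finA in \<open>auto simp: inj_on_def\<close>)
  define \<S> where "\<S> = (\<lambda>c. (\<lambda>x. (x, r x)) ` ?A c) ` {..<K} \<union> (\<lambda>c. (\<lambda>x. (r x, x)) ` ?A c) ` {..<K}"
  show thesis
  proof (rule that[of D \<S> \<mu>])
    show "finite \<S>" by (simp add: \<S>_def)
    have "card \<S> \<le> card ((\<lambda>c. (\<lambda>x. (x, r x)) ` ?A c) ` {..<K}) + card ((\<lambda>c. (\<lambda>x. (r x, x)) ` ?A c) ` {..<K})"
      unfolding \<S>_def by (rule card_Un_le)
    also have "\<dots> \<le> card {..<K} + card {..<K}" by (intro add_mono card_image_le) auto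
    finally show "card \<S> \<le> 2 * K" by simp
    have "D = (\<Union>c<K. ?A c)" using f by auto
    then show "\<Union>\<S> = (\<lambda>x. (x, r x)) ` D \<union> (\<lambda>x. (r x, x)) ` D"
      unfolding \<S>_def Union_Un_distrib image_UN[symmetric] by simp
    show "feasible \<alpha> \<beta> (mean_power \<alpha>) S" if "S \<in> \<S>" for S using that fwd bwd by (auto simp: \<S>_def)
    show "real (card Q) / 4 \<le> real (card D)" using D(2) cardG by linarith
  qed (use DQ \<mu> in auto)
qed

end

section \<open>Rounds of nearest-neighbour links\<close>

text \<open>The bound of \<open>sum_capped_affectance\<close> per point. With \<open>N\<close> and
  \<open>R\<close> taken from the initial point set, it is the same in every round.\<close>

definition affectance_bound :: "real \<Rightarrow> real \<Rightarrow> real \<Rightarrow> real" where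
  "affectance_bound \<alpha> N R = 2 * (36 * 2 powr \<alpha> / (1 - 2 powr - (min \<alpha> 4 - 2)))
     + (81 * (log 2 (32 * N\<^sup>2) + 2) + 25 * (loglog R + 1) + 1)"

lemma ex_nearest_neighbours:
  assumes "finite Q" "2 \<le> card Q"
  shows "\<exists>r. nearest_neighbours Q r"
proof -
  have "\<exists>z. z \<in> Q - {x} \<and> (\<forall>y\<in>Q - {x}. dist x z \<le> dist x y)" if "x \<in> Q" for x
  proof -
    have ne: "Q - {x} \<noteq> {}"
    proof
      assume "Q - {x} = {}"
      then have "Q = {x}" using that by blast
      then show False using assms(2) by simp
    qed
    have "finite (Q - {x})" using assms(1) by simp
    then show ?thesis using arg_min_if_finite[OF _ ne, of "dist x"] arg_min_least[OF _ ne, of _ "dist x"] by blast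
  qed
  then obtain r where "\<And>x. x \<in> Q \<Longrightarrow> r x \<in> Q - {x} \<and> (\<forall>y\<in>Q - {x}. dist x (r x) \<le> dist x y)" by metis
  then have "nearest_neighbours Q r" using assms(1) by unfold_locales auto
  then show ?thesis by blast
qed

text \<open>The bounds \<open>N\<close> and \<open>R\<close> pass to subsets, so one
  \<open>K\<close> serves all rounds. A round removes at least a quarter of the points using at most
  \<open>2 * K\<close> slots, and its links in both directions tie each removed point to a remaining
  one.\<close>

lemma ex_feasible_cover:
  fixes \<alpha> \<beta> N R :: real and K :: nat
  assumes ab: "2 < \<alpha>" "1 \<le> \<beta>" and "1 \<le> N" "0 < K"
    and K: "4 * \<beta> * affectance_bound \<alpha> N R \<le> real K"
  shows "finite Q \<Longrightarrow> Q \<noteq> {} \<Longrightarrow> real (card Q) \<le> N \<Longrightarrow>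
    (\<And>x y x' y'. x \<in> Q \<Longrightarrow> y \<in> Q \<Longrightarrow> x' \<in> Q \<Longrightarrow> y' \<in> Q \<Longrightarrow> x' \<noteq> y' \<Longrightarrow> dist x y \<le> R * dist x' y') \<Longrightarrow>
    \<exists>\<S>. finite \<S> \<and> strongly_connects (\<Union>\<S>) Q \<and> (\<forall>S\<in>\<S>. feasible \<alpha> \<beta> (mean_power \<alpha>) S) \<and>
        real (card \<S>) \<le> 2 * real K * log (4/3) (real (card Q))"
proof (induction "card Q" arbitrary: Q rule: less_induct)
  case less
  show ?case
  proof (cases "card Q = 1")
    case True
    then obtain x where "Q = {x}" by (auto simp: card_1_singleton_iff)
    then show ?thesis by (intro exI[of _ "{}"]) (auto simp: strongly_connects_def)
  next
    case False
    then have card2: "2 \<le> card Q" using less.prems(1,2) card_gt_0_iff[of Q] by linarith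
    obtain r where "nearest_neighbours Q r" using ex_nearest_neighbours[OF less.prems(1) card2] by blast
    then interpret nearest_neighbours Q r .
    have ratio: "len y \<le> R * len x" if "x \<in> Q" "y \<in> Q" for x y
      unfolding len_def using that r_in r_neq less.prems(4)[of y "r y" x "r x"] by metis
    have sum: "(\<Sum>x\<in>Q. \<Sum>y\<in>Q - {x}. capped_affectance \<alpha> x y) \<le> real (card Q) * affectance_bound \<alpha> N R"
      unfolding affectance_bound_def
      by (rule sum_capped_affectance[OF ab(1) assms(3) less.prems(3)]) (rule ratio)
    obtain D \<S> and \<mu> :: "point \<Rightarrow> nat" where D1: "D \<subseteq> Q"
      and \<S>: "finite \<S>" "card \<S> \<le> 2 * K"
      and links: "\<Union>\<S> = (\<lambda>x. (x, r x)) ` D \<union> (\<lambda>x. (r x, x)) ` D"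
      and feas: "\<And>S. S \<in> \<S> \<Longrightarrow> feasible \<alpha> \<beta> (mean_power \<alpha>) S"
      and D2: "real (card Q) / 4 \<le> real (card D)"
      and \<mu>: "\<And>x. x \<in> D \<Longrightarrow> \<mu> (r x) < \<mu> x"
      by (rule ex_feasible_links[OF ab(2) \<open>0 < K\<close> sum K]) blast
    define Q' where "Q' = Q - D"
    \<comment> \<open>Induction on \<open>\<mu>\<close>: following \<open>r\<close> from a point of
      \<open>D\<close> decreases \<open>\<mu>\<close> and so ends outside \<open>D\<close>. This
      also makes \<open>Q'\<close> nonempty.\<close>
    have reach_aux: "\<exists>z\<in>Q'. (x, z) \<in> (\<Union>\<S>)\<^sup>* \<and> (z, x) \<in> (\<Union>\<S>)\<^sup>*" if "x \<in> Q" for x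
      using that
    proof (induction "\<mu> x" arbitrary: x rule: less_induct)
      case (less x)
      show ?case
      proof (cases "x \<in> D")
        case True
        then obtain z where z: "z \<in> Q'" "(r x, z) \<in> (\<Union>\<S>)\<^sup>*" "(z, r x) \<in> (\<Union>\<S>)\<^sup>*"
          using less.hyps[OF \<mu>[OF True] r_in[OF less.prems]] by blast
        have "(x, r x) \<in> \<Union>\<S>" "(r x, x) \<in> \<Union>\<S>" unfolding links using True by auto
        then have "(x, z) \<in> (\<Union>\<S>)\<^sup>*" "(z, x) \<in> (\<Union>\<S>)\<^sup>*"
          using z(2,3) by (auto intro: converse_rtrancl_into_rtrancl rtrancl_into_rtrancl)
        with z(1) show ?thesis by blast
      next
        case False
        then show ?thesis using less.prems by (auto simp: Q'_def)
      qed
    qed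
    have Q': "finite Q'" "Q' \<noteq> {}" "Q' \<subseteq> Q" using less.prems(1,2) reach_aux by (auto simp: Q'_def)
    have cardQ': "real (card Q') = real (card Q) - real (card D)"
      unfolding Q'_def using D1 less.prems(1)
      by (simp add: card_Diff_subset finite_subset card_mono of_nat_diff)
    have pos: "0 < card Q'" using Q' by (simp add: card_gt_0_iff)
    have lt: "card Q' < card Q" using cardQ' D2 card2 by linarith
    obtain \<S>' where \<S>': "finite \<S>'" "strongly_connects (\<Union>\<S>') Q'"
      "\<And>S. S \<in> \<S>' \<Longrightarrow> feasible \<alpha> \<beta> (mean_power \<alpha>) S"
      "real (card \<S>') \<le> 2 * real K * log (4/3) (real (card Q'))"
      using less.hyps[OF lt Q'(1,2)] less.prems(3,4) lt Q'(3) by (smt (verit) of_nat_less_iff subsetD)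
    let ?L = "\<Union>(\<S> \<union> \<S>')"
    have mono: "(\<Union>\<S>)\<^sup>* \<subseteq> ?L\<^sup>*" "(\<Union>\<S>')\<^sup>* \<subseteq> ?L\<^sup>*" by (intro rtrancl_mono; blast)+
    have "strongly_connects ?L Q"
      unfolding strongly_connects_def
    proof (intro conjI ballI)
      have "\<Union>\<S> \<subseteq> Q \<times> Q" unfolding links using D1 r_in by auto
      moreover have "\<Union>\<S>' \<subseteq> Q \<times> Q"
        using \<S>'(2) Q'(3) unfolding strongly_connects_def by (meson Sigma_mono order_trans)
      ultimately show "?L \<subseteq> Q \<times> Q" unfolding Union_Un_distrib by (rule Un_least)
      have "case l of (s, t) \<Rightarrow> s \<noteq> t" if "l \<in> \<Union>\<S>" for l
        using that D1 r_neq unfolding links by (auto dest: sym)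
      moreover have "case l of (s, t) \<Rightarrow> s \<noteq> t" if "l \<in> \<Union>\<S>'" for l
        using that \<S>'(2) unfolding strongly_connects_def by blast
      ultimately show "case l of (s, t) \<Rightarrow> s \<noteq> t" if "l \<in> ?L" for l
        using that unfolding Union_Un_distrib by blast
      fix u v assume "u \<in> Q" "v \<in> Q"
      then obtain u' v' where uv: "u' \<in> Q'" "(u, u') \<in> (\<Union>\<S>)\<^sup>*" "v' \<in> Q'" "(v', v) \<in> (\<Union>\<S>)\<^sup>*"
        using reach_aux by meson
      then have "(u', v') \<in> (\<Union>\<S>')\<^sup>*" using \<S>'(2) by (auto simp: strongly_connects_def)
      then show "(u, v) \<in> ?L\<^sup>*" using uv mono by (meson rtrancl_trans subsetD)
    qed
    moreover have "real (card (\<S> \<union> \<S>')) \<le> 2 * real K * log (4/3) (real (card Q))"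
    proof -
      have "real (card (\<S> \<union> \<S>')) \<le> real (card \<S>) + real (card \<S>')"
        using card_Un_le[of \<S> \<S>'] by linarith
      also have "\<dots> \<le> 2 * real K + 2 * real K * log (4/3) (real (card Q'))"
        using \<S>(2) \<S>'(4) by linarith
      \<comment> \<open>Since \<open>log (4/3) (4/3) = 1\<close>, the slots of this round become a
        factor \<open>4/3\<close> in the argument, and at least a quarter of the points is
        gone.\<close>
      also have "\<dots> = 2 * real K * log (4/3) (4/3 * real (card Q'))"
        using pos by (subst log_mult) (auto simp: distrib_left)
      also have "\<dots> \<le> 2 * real K * log (4/3) (real (card Q))"
        using pos lt cardQ' D2 by (intro mult_left_mono) (auto simp: log_le_cancel_iff)
      finally show ?thesis .
    qed
    ultimately show ?thesis using \<S>(1) feas \<S>'(1,3) by (intro exI[of _ "\<S> \<union> \<S>'"]) auto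
  qed
qed

section \<open>Distances and minimum spanning trees\<close>

lemma diameter_pair: "diameter {x, y} = dist x y" for x y :: "'a::real_normed_vector"
proof (rule antisym)
  show "diameter {x, y} \<le> dist x y" by (rule diameter_le) (auto simp: dist_norm norm_minus_commute)
  show "dist x y \<le> diameter {x, y}" by (rule diameter_bounded_bound) auto
qed

text \<open>The rest of the cycle is a detour between the endpoints of the removed edge.\<close>

lemma rtrancl_remove_cycle_edge:
  fixes E :: "'a set set"
  assumes c: "3 \<le> length c" "distinct c"
    and edges: "\<And>i. i < length c \<Longrightarrow> {c ! i, c ! (Suc i mod length c)} \<in> E"
    and i: "i < length c"
  shows "{(x, y). {x, y} \<in> E}\<^sup>* \<subseteq> {(x, y). {x, y} \<in> E - {{c ! i, c ! (Suc i mod length c)}}}\<^sup>*"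
proof -
  let ?L = "length c"
  define e where "e = {c ! i, c ! (Suc i mod ?L)}"
  let ?S = "{(x, y). {x, y} \<in> E - {e}}"
  have walk: "(c ! (Suc i mod ?L), c ! ((i + Suc k) mod ?L)) \<in> ?S\<^sup>*" if "Suc k \<le> ?L" for k
    using that
  proof (induction k)
    case (Suc k)
    let ?a = "(i + Suc k) mod ?L"
    have next_eq: "Suc ?a mod ?L = (i + Suc (Suc k)) mod ?L" by (simp add: mod_Suc_eq)
    have a: "?a < ?L" "?a \<noteq> i" using i Suc.prems by (auto simp: mod_if)
    \<comment> \<open>Different positions of the cycle give the same edge only if
      \<open>(i + 2) mod ?L = i\<close>, which fails for length at least 3.\<close>
    have "{c ! ?a, c ! (Suc ?a mod ?L)} \<noteq> e"
    proof
      assume "{c ! ?a, c ! (Suc ?a mod ?L)} = e"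
      moreover have "c ! ?a \<noteq> c ! i" using a i c(2) by (simp add: nth_eq_iff_index_eq)
      ultimately have "c ! ?a = c ! (Suc i mod ?L)" "c ! (Suc ?a mod ?L) = c ! i"
        unfolding e_def by (metis doubleton_eq_iff)+
      moreover have "Suc i mod ?L < ?L" "Suc ?a mod ?L < ?L" using i by (auto intro!: mod_less_divisor)
      ultimately have "?a = Suc i mod ?L" "Suc ?a mod ?L = i"
        using a i c(2) by (simp_all only: nth_eq_iff_index_eq)
      then have eq: "(i + 2) mod ?L = i" by (simp add: mod_Suc_eq)
      show False
      proof (cases "i + 2 < ?L")
        case False
        then have "(i + 2) mod ?L = i + 2 - ?L" using i c(1) by (simp add: le_mod_geq)
        then show False using eq c(1) False by linarith
      qed (use eq in simp)
    qed
    then have "(c ! ?a, c ! ((i + Suc (Suc k)) mod ?L)) \<in> ?S"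
      using edges[OF a(1)] unfolding next_eq by auto
    then show ?case using Suc by (auto intro: rtrancl_into_rtrancl)
  qed simp
  have sym: "sym ?S" by (auto simp: sym_def insert_commute)
  have "i + Suc (?L - 1) = i + ?L" using c(1) by linarith
  then have eq: "(i + Suc (?L - 1)) mod ?L = i" using i by simp
  have bwd: "(c ! (Suc i mod ?L), c ! i) \<in> ?S\<^sup>*"
    by (rule walk[of "?L - 1", unfolded eq]) (use c(1) in linarith)
  then have fwd: "(c ! i, c ! (Suc i mod ?L)) \<in> ?S\<^sup>*"
    using sym by (meson sym_rtrancl symD)
  have "{(x, y). {x, y} \<in> E} \<subseteq> ?S\<^sup>*"
  proof clarify
    fix x y assume xy: "{x, y} \<in> E"
    show "(x, y) \<in> ?S\<^sup>*"
    proof (cases "{x, y} = e")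
      case True
      then show ?thesis using bwd fwd unfolding e_def by (auto simp: doubleton_eq_iff)
    qed (use xy in auto)
  qed
  then show ?thesis unfolding e_def by (rule rtrancl_subset_rtrancl)
qed

lemma Min_edge_le_dist:
  assumes "finite P" and mst: "minimum_spanning_tree P T" and uv: "u \<in> P" "v \<in> P" "u \<noteq> v"
  shows "Min (diameter ` T) \<le> dist u v"
proof (rule ccontr)
  assume less: "\<not> ?thesis"
  define conn where "conn E \<longleftrightarrow> (\<forall>x\<in>P. \<forall>y\<in>P. (x, y) \<in> {(x, y). {x, y} \<in> E}\<^sup>*)" for E :: "point set set"
  let ?C = "\<lambda>E c. 3 \<le> length c \<and> distinct c \<and> (\<forall>i<length c. {c ! i, c ! (Suc i mod length c)} \<in> E)"
  have st: "spanning_tree P T" using mst by (simp add: minimum_spanning_tree_def)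
  then have T_edges: "T \<subseteq> {{x, y} | x y. x \<in> P \<and> y \<in> P \<and> x \<noteq> y}" and connT: "conn T"
    by (auto simp: spanning_tree_def conn_def)
  have "T \<subseteq> Pow P" using T_edges by auto
  then have finT: "finite T" using assms(1) by (meson finite_Pow_iff finite_subset)
  have lt: "dist u v < diameter e" if "e \<in> T" for e
  proof -
    have "Min (diameter ` T) \<le> diameter e" using finT that by (intro Min_le) auto
    with less show ?thesis by linarith
  qed
  then have uvT: "{u, v} \<notin> T" by (metis diameter_pair less_irrefl)
  txt \<open>
    Exchange argument: a smallest connected subgraph of \<open>T\<close> plus \<open>{u, v}\<close> that contains \<open>{u, v}\<close> is a
    spanning tree, and it omits an edge of \<open>T\<close>.
  \<close>
  define \<E> where "\<E> E \<longleftrightarrow> {u, v} \<in> E \<and> E \<subseteq> insert {u, v} T \<and> conn E" for E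
  have "conn (insert {u, v} T)"
    using connT rtrancl_mono[of "{(x, y). {x, y} \<in> T}" "{(x, y). {x, y} \<in> insert {u, v} T}"]
    unfolding conn_def by blast
  then have "\<E> (insert {u, v} T)" by (simp add: \<E>_def)
  then obtain E where E: "\<E> E" and minE: "\<And>E'. \<E> E' \<Longrightarrow> card E \<le> card E'"
    using ex_has_least_nat[of \<E> _ card] by metis
  have subE: "E \<subseteq> insert {u, v} T" and uvE: "{u, v} \<in> E" and connE: "conn E" using E by (auto simp: \<E>_def)
  have finE: "finite E" using subE finT by (meson finite.insertI finite_subset)
  have acyclic: "\<not> ?C E c" for c
  proof
    assume c: "?C E c"
    \<comment> \<open>Two different cycle edges cannot both be \<open>{u, v}\<close>, so one can be
      deleted while \<open>{u, v}\<close> stays.\<close>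
    have neq: "{c ! 0, c ! (Suc 0 mod length c)} \<noteq> {c ! 1, c ! (Suc 1 mod length c)}"
    proof -
      have "c ! 0 \<noteq> c ! 1" "c ! 0 \<noteq> c ! 2" using c by (subst nth_eq_iff_index_eq; auto)+
      then show ?thesis using c by (auto simp: doubleton_eq_iff mod_if numeral_2_eq_2)
    qed
    have "0 < length c" "1 < length c" using c by linarith+
    then obtain i where i: "i < length c" "{c ! i, c ! (Suc i mod length c)} \<noteq> {u, v}"
      using neq that[of 0] that[of 1] by argo
    let ?e = "{c ! i, c ! (Suc i mod length c)}"
    have "conn (E - {?e})"
      using connE rtrancl_remove_cycle_edge[of c E i] c i(1) unfolding conn_def by blast
    then have "\<E> (E - {?e})" using uvE subE i(2) by (auto simp: \<E>_def)
    then have "card E \<le> card (E - {?e})" by (rule minE)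
    moreover have "?e \<in> E" using c i(1) by blast
    ultimately show False using finE card_Diff1_less[of E ?e] by linarith
  qed
  have stE: "spanning_tree P E"
    unfolding spanning_tree_def
  proof (intro conjI)
    have "insert {u, v} T \<subseteq> {{x, y} | x y. x \<in> P \<and> y \<in> P \<and> x \<noteq> y}" using T_edges uv by auto
    with subE show "E \<subseteq> {{x, y} | x y. x \<in> P \<and> y \<in> P \<and> x \<noteq> y}" by (rule order_trans)
    show "\<forall>x\<in>P. \<forall>y\<in>P. (x, y) \<in> {(x, y). {x, y} \<in> E}\<^sup>*" using connE by (simp only: conn_def)
    show "\<not> (\<exists>c. ?C E c)" using acyclic by blast
  qed
  \<comment> \<open>Otherwise a path in \<open>T\<close> from \<open>u\<close> to \<open>v\<close>,
    closed by \<open>{u, v}\<close>, would be a cycle in \<open>E\<close>.\<close>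
  have "E \<noteq> insert {u, v} T"
  proof
    assume eq: "E = insert {u, v} T"
    let ?r = "\<lambda>x y. {x, y} \<in> T"
    have "(u, v) \<in> {(x, y). ?r x y}\<^sup>*" using connT uv by (auto simp: conn_def)
    then have "?r\<^sup>*\<^sup>* u v" by (simp add: rtranclp_rtrancl_eq)
    then obtain xs where "rtrancl_path ?r u xs v" by (auto simp: rtranclp_eq_rtrancl_path)
    then obtain ys where ys: "rtrancl_path ?r u ys v" "distinct (u # ys)" by (rule rtrancl_path_distinct)
    have "ys \<noteq> []" using ys(1) uv(3) by (auto elim: rtrancl_path.cases)
    have last: "last ys = v" using rtrancl_path_last[OF ys(1) \<open>ys \<noteq> []\<close>] .
    have "length ys \<noteq> 1"
    proof
      assume "length ys = 1"
      then have "ys = [v]" using last by (cases ys) auto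
      then show False using rtrancl_path_nth[OF ys(1), of 0] uvT by simp
    qed
    then have "3 \<le> length (u # ys)" using \<open>ys \<noteq> []\<close> by (cases ys rule: list.exhaust) (auto simp: Suc_le_eq)
    moreover have "{(u # ys) ! i, (u # ys) ! (Suc i mod length (u # ys))} \<in> E" if i: "i < length (u # ys)" for i
    proof (cases "i < length ys")
      case True
      then show ?thesis using rtrancl_path_nth[OF ys(1) True] eq by simp
    next
      case False
      then have "i = length ys" using i by simp
      moreover have "(u # ys) ! length ys = v" using last \<open>ys \<noteq> []\<close> by (simp add: last_conv_nth nth_Cons')
      ultimately show ?thesis using uvE by (simp add: insert_commute)
    qed
    ultimately show False using acyclic[of "u # ys"] ys(2) by blast
  qed
  then obtain e where e: "e \<in> T" "e \<notin> E" using subE uvE by blast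
  have nonneg: "0 \<le> diameter f" if "f \<in> insert {u, v} T" for f
    using that lt by (metis diameter_pair insertE less_le order_trans zero_le_dist)
  have "(\<Sum>f\<in>E. diameter f) \<le> (\<Sum>f\<in>insert {u, v} (T - {e}). diameter f)"
    using subE e finT nonneg by (intro sum_mono2) auto
  also have "\<dots> = dist u v + (\<Sum>f\<in>T - {e}. diameter f)" using finT uvT by (simp add: diameter_pair)
  also have "\<dots> < diameter e + (\<Sum>f\<in>T - {e}. diameter f)" using lt[OF e(1)] by simp
  also have "\<dots> = (\<Sum>f\<in>T. diameter f)" using finT e(1) by (simp add: sum.remove)
  also have "\<dots> \<le> (\<Sum>f\<in>E. diameter f)" using mst stE by (simp add: minimum_spanning_tree_def)
  finally show False by simp
qed

text \<open>Edge lengths add up along a path. The number of its edges is bounded crudely by the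
  number of pairs of points, which suffices because this factor enters the slot count only through
  \<open>loglog\<close>.\<close>

lemma dist_le_Max_edge:
  assumes "finite P" and st: "spanning_tree P T" and xy: "x \<in> P" "y \<in> P" "x \<noteq> y"
  shows "dist x y \<le> (real (card P))\<^sup>2 * Max (diameter ` T)"
proof -
  let ?R = "{(x, y). {x, y} \<in> T}" and ?M = "Max (diameter ` T)"
  have "T \<subseteq> Pow P" using st by (auto simp: spanning_tree_def)
  then have finT: "finite T" using assms(1) by (meson finite_Pow_iff finite_subset)
  have sub: "?R \<subseteq> P \<times> P" using \<open>T \<subseteq> Pow P\<close> by auto
  then have finR: "finite ?R" using assms(1) by (meson finite_SigmaI finite_subset)
  have edge: "dist a b \<le> ?M" if "(a, b) \<in> ?R" for a b
    using that finT diameter_pair[of a b] by (auto intro!: Max_ge simp flip: diameter_pair)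
  have path: "dist a b \<le> real k * ?M" if "(a, b) \<in> ?R ^^ k" for a b k
    using that
  proof (induction k arbitrary: b)
    case (Suc k)
    then obtain c where c: "(a, c) \<in> ?R ^^ k" "(c, b) \<in> ?R" by auto
    have "dist a b \<le> dist a c + dist c b" by (rule dist_triangle)
    also have "\<dots> \<le> real k * ?M + ?M" using Suc.IH[OF c(1)] edge[OF c(2)] by linarith
    finally show ?case by (simp add: algebra_simps)
  qed simp
  have "(x, y) \<in> ?R\<^sup>*" using st xy by (auto simp: spanning_tree_def)
  then obtain k where k: "k \<le> card ?R" "(x, y) \<in> ?R ^^ k"
    using rtrancl_finite_eq_relpow[OF finR] by auto
  have "k \<noteq> 0" using k(2) xy(3) by (cases k) auto
  then have "?R \<noteq> {}" using k(1) by force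
  then obtain a b where "(a, b) \<in> ?R" by blast
  then have M: "0 \<le> ?M" using edge[of a b] zero_le_dist[of a b] by linarith
  have "card ?R \<le> (card P)\<^sup>2"
    using card_mono[OF _ sub] assms(1) by (simp add: card_cartesian_product power2_eq_square)
  then have "real k \<le> real ((card P)\<^sup>2)" using k(1) by (intro of_nat_mono) (rule order_trans)
  then have "real k \<le> (real (card P))\<^sup>2" by simp
  then have "real k * ?M \<le> (real (card P))\<^sup>2 * ?M" using M by (rule mult_right_mono)
  then show ?thesis using path[OF k(2)] by linarith
qed

text \<open>Provides the ratio \<open>R\<close> for every round, since the inequality is inherited
  by all subsets of \<open>P\<close>.\<close>

lemma dist_le_edge_ratio:
  assumes fin: "finite P" and mst: "minimum_spanning_tree P T"
    and xy: "x \<in> P" "y \<in> P" and uv: "u \<in> P" "v \<in> P" "u \<noteq> v"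
  shows "dist x y \<le> (real (card P))\<^sup>2 * edge_ratio T * dist u v"
proof -
  let ?M = "Max (diameter ` T)" and ?m = "Min (diameter ` T)"
  have st: "spanning_tree P T" using mst by (simp add: minimum_spanning_tree_def)
  then have T_edges: "T \<subseteq> {{x, y} | x y. x \<in> P \<and> y \<in> P \<and> x \<noteq> y}" by (simp add: spanning_tree_def)
  then have "T \<subseteq> Pow P" by auto
  then have finT: "finite T" using fin by (meson finite_Pow_iff finite_subset)
  have "(u, v) \<in> {(x, y). {x, y} \<in> T}\<^sup>*" using st uv by (simp add: spanning_tree_def)
  then have "T \<noteq> {}" using uv(3) by (auto elim: converse_rtranclE)
  have "0 < diameter e" if "e \<in> T" for e using that T_edges by (auto simp: diameter_pair)
  then have m: "0 < ?m" using finT \<open>T \<noteq> {}\<close> by (subst Min_gr_iff) auto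
  have mM: "?m \<le> ?M" using finT \<open>T \<noteq> {}\<close> by (intro Min.coboundedI Max_in) auto
  have "dist x y \<le> (real (card P))\<^sup>2 * ?M"
    using dist_le_Max_edge[OF fin st xy] m mM by (cases "x = y") auto
  also have "\<dots> = (real (card P))\<^sup>2 * edge_ratio T * ?m" using m by (simp add: edge_ratio_def)
  also have "\<dots> \<le> (real (card P))\<^sup>2 * edge_ratio T * dist u v"
    using Min_edge_le_dist[OF fin mst uv] m mM by (intro mult_left_mono) (auto simp: edge_ratio_def)
  finally show ?thesis .
qed

section \<open>The number of slots\<close>

lemma loglog_nonneg: "0 \<le> loglog x"
proof -
  have "1 \<le> log 2 (max 2 x)" by (subst le_log_iff) auto
  then show ?thesis by (simp add: loglog_def)
qed

text \<open>The inner logarithm turns the product into a sum \<open>a + b\<close> with both terms at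
  least 1; \<open>a + b \<le> 2 * (a * b)\<close> restores a product for the outer one. The 2 in the
  bound is \<open>log 2 4\<close>, and \<open>log 2 (log 2 n)\<close> is estimated by
  \<open>log 2 n\<close>.\<close>

lemma loglog_mult_le:
  fixes n :: nat
  assumes "2 \<le> n"
  shows "loglog ((real n)\<^sup>2 * x) \<le> 2 + log 2 (real n) + loglog x"
proof -
  let ?a = "log 2 (max 2 x)" and ?b = "2 * log 2 (real n)"
  have a: "1 \<le> ?a" by (subst le_log_iff) auto
  have l: "1 \<le> log 2 (real n)" using assms by (subst le_log_iff) auto
  have n1: "1 \<le> (real n)\<^sup>2" using assms by (intro one_le_power) simp
  have m1: "1 \<le> max 2 ((real n)\<^sup>2 * x)" by simp
  have "max 2 ((real n)\<^sup>2 * x) \<le> (real n)\<^sup>2 * max 2 x"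
  proof (rule max.boundedI)
    have "max 2 x \<le> (real n)\<^sup>2 * max 2 x" using mult_right_mono[OF n1, of "max 2 x"] by simp
    then show "2 \<le> (real n)\<^sup>2 * max 2 x" by linarith
  qed (simp add: mult_left_mono)
  then have "log 2 (max 2 ((real n)\<^sup>2 * x)) \<le> log 2 ((real n)\<^sup>2 * max 2 x)"
    using m1 by (intro log_mono) auto
  also have "\<dots> = ?a + ?b" using assms by (subst log_mult) (auto simp: log_nat_power)
  also have "\<dots> \<le> 2 * (?a * ?b)"
  proof -
    have "?a \<le> ?a * ?b" "?b \<le> ?a * ?b" using a l by (auto simp: mult_le_cancel_left1 mult_le_cancel_right1)
    then show ?thesis by linarith
  qed
  finally have "log 2 (max 2 ((real n)\<^sup>2 * x)) \<le> 4 * (?a * log 2 (real n))" by simp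
  moreover have "1 \<le> log 2 (max 2 ((real n)\<^sup>2 * x))" by (subst le_log_iff) auto
  ultimately have "loglog ((real n)\<^sup>2 * x) \<le> log 2 (4 * (?a * log 2 (real n)))"
    unfolding loglog_def by (intro log_mono) auto
  also have "\<dots> = log 2 4 + (loglog x + log 2 (log 2 (real n)))"
  proof -
    have "log 2 (4 * (s * t)) = log 2 4 + (log 2 s + log 2 t)" if "1 \<le> s" "1 \<le> t" for s t :: real
      using that by (simp add: log_mult)
    from this[OF a l] show ?thesis by (simp only: loglog_def)
  qed
  also have "log 2 (4::real) = 2" using log_nat_power[of 2 2 2] by simp
  also have "log 2 (log 2 (real n)) \<le> log 2 (real n)"
  proof (rule log_mono)
    have "real n \<le> 2 powr real n" using of_nat_less_two_power[of n, where ?'a = real] by (simp add: powr_realpow)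
    then show "log 2 (real n) \<le> real n" using assms by (subst log_le_iff) auto
  qed (use l in auto)
  finally show ?thesis by simp
qed

lemma affectance_bound_le:
  fixes n :: nat
  assumes "2 < \<alpha>" "2 \<le> n"
  shows "affectance_bound \<alpha> (real n) ((real n)\<^sup>2 * \<Delta>)
    \<le> (2 * (36 * 2 powr \<alpha> / (1 - 2 powr - (min \<alpha> 4 - 2))) + 830) * (loglog \<Delta> + log 2 (real n))"
proof -
  define F where "F = 2 * (36 * 2 powr \<alpha> / (1 - 2 powr - (min \<alpha> 4 - 2)))"
  have l: "1 \<le> log 2 (real n)" using assms(2) by (subst le_log_iff) auto
  have ll: "0 \<le> loglog \<Delta>" by (rule loglog_nonneg)
  have "log 2 (32 * (real n)\<^sup>2) = log 2 32 + 2 * log 2 (real n)"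
    using assms(2) by (subst log_mult) (auto simp: log_nat_power)
  also have "log 2 (32::real) = 5" using log_nat_power[of 2 2 5] by simp
  \<comment> \<open>Here \<open>643 = 81 * 7 + 25 * 3 + 1\<close> and
    \<open>187 = 81 * 2 + 25\<close>. Below, \<open>830 = 643 + 187\<close>, as
    \<open>log 2 n\<close> is at least 1.\<close>
  finally have "affectance_bound \<alpha> (real n) ((real n)\<^sup>2 * \<Delta>) \<le> F + 643 + 187 * log 2 (real n) + 25 * loglog \<Delta>"
    using loglog_mult_le[OF assms(2), of \<Delta>] unfolding affectance_bound_def F_def[symmetric] by argo
  also have "\<dots> \<le> (F + 830) * (loglog \<Delta> + log 2 (real n))"
  proof -
    have "2 powr - (min \<alpha> 4 - 2) < 1" using assms(1) by (intro powr_less_one) auto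
    then have F: "0 \<le> F" by (simp add: F_def)
    have "F * 1 \<le> F * (loglog \<Delta> + log 2 (real n))" using F l ll by (intro mult_left_mono) auto
    then show ?thesis using l ll by (simp add: distrib_right)
  qed
  finally show ?thesis by (simp only: F_def)
qed

theorem theorem8:
  fixes \<alpha> \<beta> :: real
  assumes "\<alpha> > 2" and "\<beta> \<ge> 1"
  shows "\<exists>C>0. \<forall>(P :: point set) T n.
           finite P \<longrightarrow> card P = n \<longrightarrow> minimum_spanning_tree P T \<longrightarrow>
           (\<exists>k. strongly_connectable \<alpha> \<beta> (mean_power \<alpha>) P k \<and>
                real k \<le> C * (log 2 (real n) * (loglog (edge_ratio T) + log 2 (real n))))"
proof -
  define c where "c = 2 * (36 * 2 powr \<alpha> / (1 - 2 powr - (min \<alpha> 4 - 2))) + 830"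
  \<comment> \<open>\<open>K\<close> will be at most \<open>(4 * \<beta> * c + 2) * m\<close>; the
    factor 2 counts the orientations, and \<open>log 2 (4/3)\<close> changes the base in the number
    of rounds.\<close>
  define C where "C = 2 * (4 * \<beta> * c + 2) / log 2 (4/3)"
  have "2 powr - (min \<alpha> 4 - 2) < 1" using assms(1) by (intro powr_less_one) auto
  then have "0 < c" by (auto simp: c_def intro!: add_nonneg_pos)
  have "0 < C" using \<open>0 < c\<close> assms(2) by (auto simp: C_def intro!: divide_pos_pos add_pos_pos)
  have "\<exists>k. strongly_connectable \<alpha> \<beta> (mean_power \<alpha>) P k \<and>
      real k \<le> C * (log 2 (real n) * (loglog (edge_ratio T) + log 2 (real n)))"
    if fin: "finite P" and card: "card P = n" and mst: "minimum_spanning_tree P T" for P T n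
  proof (cases "2 \<le> n")
    case False
    have "u = v" if "u \<in> P" "v \<in> P" for u v
      using card_le_Suc0_iff_eq[OF fin] False card that by auto
    then have "strongly_connects (\<Union>{}) P" by (auto simp: strongly_connects_def)
    then obtain k where "k \<le> card ({} :: link set set)" "strongly_connectable \<alpha> \<beta> (mean_power \<alpha>) P k"
      using strongly_connectable_cover[of "{}" P \<alpha> \<beta> "mean_power \<alpha>"] fin by auto
    \<comment> \<open>For \<open>n = 0\<close> this uses the convention
      \<open>log 2 0 = 0\<close>.\<close>
    moreover have "log 2 (real n) = 0" using False by (cases "n = 0") (auto simp: log_def not_le less_2_cases_iff)
    ultimately show ?thesis by auto
  next
    case True
    let ?\<Delta> = "edge_ratio T"
    define m where "m = loglog ?\<Delta> + log 2 (real n)"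
    have l: "1 \<le> log 2 (real n)" using True by (subst le_log_iff) auto
    have m: "1 \<le> m" using l loglog_nonneg[of ?\<Delta>] by (simp add: m_def)
    have P: "P \<noteq> {}" using True card by auto
    have ratio: "dist x y \<le> (real n)\<^sup>2 * ?\<Delta> * dist x' y'"
      if "x \<in> P" "y \<in> P" "x' \<in> P" "y' \<in> P" "x' \<noteq> y'" for x y x' y'
      using dist_le_edge_ratio[OF fin mst that] card by simp
    \<comment> \<open>The added 1 makes \<open>K\<close> positive. Together with rounding up, the
      excess is at most 2, absorbed because \<open>m\<close> is at least 1.\<close>
    define K where "K = nat \<lceil>4 * \<beta> * (c * m)\<rceil> + 1"
    have pos: "0 \<le> 4 * \<beta> * (c * m)" using \<open>0 < c\<close> m assms(2) by simp
    have "affectance_bound \<alpha> n ((real n)\<^sup>2 * ?\<Delta>) \<le> c * m"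
      using affectance_bound_le[OF assms(1) True] by (simp add: c_def m_def)
    then have "4 * \<beta> * affectance_bound \<alpha> n ((real n)\<^sup>2 * ?\<Delta>) \<le> 4 * \<beta> * (c * m)"
      using assms(2) by (intro mult_left_mono) auto
    also have "\<dots> \<le> real K" unfolding K_def by linarith
    finally have K: "4 * \<beta> * affectance_bound \<alpha> n ((real n)\<^sup>2 * ?\<Delta>) \<le> real K" .
    have "real K \<le> 4 * \<beta> * (c * m) + 2" unfolding K_def using pos by linarith
    also have "\<dots> \<le> 4 * \<beta> * (c * m) + 2 * m" using m by simp
    also have "\<dots> = (4 * \<beta> * c + 2) * m" by (simp add: algebra_simps)
    finally have K_le: "real K \<le> (4 * \<beta> * c + 2) * m" .
    obtain \<S> where \<S>: "finite \<S>" "strongly_connects (\<Union>\<S>) P"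
      "\<And>S. S \<in> \<S> \<Longrightarrow> feasible \<alpha> \<beta> (mean_power \<alpha>) S"
      "real (card \<S>) \<le> 2 * real K * log (4/3) (real n)"
      using ex_feasible_cover[OF assms _ _ K fin P _ ratio] True card by (auto simp: K_def)
    obtain k where k: "k \<le> card \<S>" "strongly_connectable \<alpha> \<beta> (mean_power \<alpha>) P k"
      using strongly_connectable_cover[OF \<S>(2) fin \<S>(1,3)] by blast
    have "real k \<le> 2 * real K * log (4/3) (real n)" using k(1) \<S>(4) by linarith
    also have "\<dots> = 2 * real K * (log 2 (real n) / log 2 (4/3))"
      by (simp add: log_def)
    also have "\<dots> \<le> 2 * ((4 * \<beta> * c + 2) * m) * (log 2 (real n) / log 2 (4/3))"
      using K_le l by (intro mult_right_mono mult_left_mono) auto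
    also have "\<dots> = C * (log 2 (real n) * m)" by (simp add: C_def)
    finally show ?thesis using k(2) unfolding m_def by blast
  qed
  with \<open>0 < C\<close> show ?thesis by blast
qed

end
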